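(* Let $X=\ell_p$ (complex sequences indexed by $\mathbb Z_+$) with $2<p<\infty$. If $\mathcal O\subseteq\mathcal B_1(X)$ is $\mathrm{SOT}^*$-open in $\mathcal B_1(X)$, then the relative SOT-interior of $\mathcal O$ in $\mathcal B_1(X)$ is $\mathrm{SOT}^*$-dense in $\mathcal O$, and hence SOT-dense in $\mathcal O$ as well.
   Context: $\mathcal B_1(X)$ is the set of all bounded linear operators $T$ on $X$ with $\|T\|\le 1$. SOT is the topology of pointwise norm convergence: $T_i\to T$ iff $T_ix\to Tx$ in norm for all $x\in X$. $\mathrm{SOT}^*$ is the topology of pointwise norm convergence of operators and of their adjoints: $T_i\to T$ iff $T_ix\to Tx$ for all $x\in X$ and $T_i^*x^*\to T^*x^*$ for all $x^*\in X^*$, in norm. Openness and interiors are relative to $\mathcal B_1(X)$: the relative SOT-interior of $\mathcal O$ is the largest subset of $\mathcal O$ which is open in $(\mathcal B_1(X),\mathrm{SOT})$. *)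

theory Defs
  imports "HOL-Analysis.Analysis"
begin

section \<open>The space \<open>\<ell>\<^sub>p\<close>\<close>

text \<open>
  The exponent \<open>p\<close> is a real parameter, so \<open>\<ell>\<^sub>p\<close> is a carrier set rather than a type.
\<close>

definition lp :: "real \<Rightarrow> (nat \<Rightarrow> complex) set" where
  "lp p = {x. summable (\<lambda>n. norm (x n) powr p)}"

definition lp_norm :: "real \<Rightarrow> (nat \<Rightarrow> complex) \<Rightarrow> real" where
  "lp_norm p x = (\<Sum>n. norm (x n) powr p) powr (1 / p)"

definition lp_dist :: "real \<Rightarrow> (nat \<Rightarrow> complex) \<Rightarrow> (nat \<Rightarrow> complex) \<Rightarrow> real" where
  "lp_dist p x y = lp_norm p (\<lambda>n. x n - y n)"

definition lp_topology :: "real \<Rightarrow> (nat \<Rightarrow> complex) topology" where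
  "lp_topology p = Metric_space.mtopology (lp p) (lp_dist p)"


section \<open>Operators, the dual space and adjoints\<close>

text \<open>
  Operators and functionals are extensional (\<open>undefined\<close> off \<open>lp p\<close>), so that equality in HOL is
  equality of maps on \<open>\<ell>\<^sub>p\<close>. Linearity is over \<open>\<complex>\<close>.
\<close>

definition lp_operators :: "real \<Rightarrow> ((nat \<Rightarrow> complex) \<Rightarrow> (nat \<Rightarrow> complex)) set" where
  "lp_operators p = {T \<in> lp p \<rightarrow>\<^sub>E lp p.
     (\<forall>x\<in>lp p. \<forall>y\<in>lp p. T (\<lambda>n. x n + y n) = (\<lambda>n. T x n + T y n)) \<and>
     (\<forall>c. \<forall>x\<in>lp p. T (\<lambda>n. c * x n) = (\<lambda>n. c * T x n)) \<and>
     (\<exists>K. \<forall>x\<in>lp p. lp_norm p (T x) \<le> K * lp_norm p x)}"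

definition lp_opnorm :: "real \<Rightarrow> ((nat \<Rightarrow> complex) \<Rightarrow> (nat \<Rightarrow> complex)) \<Rightarrow> real" where
  "lp_opnorm p T = (SUP x\<in>{x \<in> lp p. lp_norm p x \<le> 1}. lp_norm p (T x))"

definition lp_contractions :: "real \<Rightarrow> ((nat \<Rightarrow> complex) \<Rightarrow> (nat \<Rightarrow> complex)) set" where
  "lp_contractions p = {T \<in> lp_operators p. lp_opnorm p T \<le> 1}"

definition lp_dual :: "real \<Rightarrow> ((nat \<Rightarrow> complex) \<Rightarrow> complex) set" where
  "lp_dual p = {\<phi> \<in> extensional (lp p).
     (\<forall>x\<in>lp p. \<forall>y\<in>lp p. \<phi> (\<lambda>n. x n + y n) = \<phi> x + \<phi> y) \<and>
     (\<forall>c. \<forall>x\<in>lp p. \<phi> (\<lambda>n. c * x n) = c * \<phi> x) \<and>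
     (\<exists>K. \<forall>x\<in>lp p. norm (\<phi> x) \<le> K * lp_norm p x)}"

definition lp_dual_norm :: "real \<Rightarrow> ((nat \<Rightarrow> complex) \<Rightarrow> complex) \<Rightarrow> real" where
  "lp_dual_norm p \<phi> = (SUP x\<in>{x \<in> lp p. lp_norm p x \<le> 1}. norm (\<phi> x))"

text \<open>
  The \<open>else\<close> branch is irrelevant for the topology; it is there because \<^locale>\<open>Metric_space\<close> asks
  for nonnegativity of the distance off the carrier as well, where the supremum may be unbounded.
\<close>

definition lp_dual_dist ::
    "real \<Rightarrow> ((nat \<Rightarrow> complex) \<Rightarrow> complex) \<Rightarrow> ((nat \<Rightarrow> complex) \<Rightarrow> complex) \<Rightarrow> real" where
  "lp_dual_dist p \<phi> \<psi> =
     (if \<phi> \<in> lp_dual p \<and> \<psi> \<in> lp_dual p then lp_dual_norm p (\<lambda>x. \<phi> x - \<psi> x) else 0)"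

definition lp_dual_topology :: "real \<Rightarrow> ((nat \<Rightarrow> complex) \<Rightarrow> complex) topology" where
  "lp_dual_topology p = Metric_space.mtopology (lp_dual p) (lp_dual_dist p)"

definition lp_adjoint :: "real \<Rightarrow> ((nat \<Rightarrow> complex) \<Rightarrow> (nat \<Rightarrow> complex)) \<Rightarrow>
    ((nat \<Rightarrow> complex) \<Rightarrow> complex) \<Rightarrow> ((nat \<Rightarrow> complex) \<Rightarrow> complex)" where
  "lp_adjoint p T = (\<lambda>\<phi>\<in>lp_dual p. \<lambda>x\<in>lp p. \<phi> (T x))"


section \<open>The topologies SOT and SOT*\<close>

text \<open>
  Both are topologies on the set of all bounded operators. Since operators are extensional, SOT is
  the trace of the product topology (pointwise norm convergence on \<open>\<ell>\<^sub>p\<close>), and SOT* is the initial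
  topology for \<open>T \<mapsto> (T, T\<^sup>*)\<close> with pointwise norm convergence in both components. The
  descriptions by convergence along filters are proved at the end.
\<close>

definition lp_SOT :: "real \<Rightarrow> ((nat \<Rightarrow> complex) \<Rightarrow> (nat \<Rightarrow> complex)) topology" where
  "lp_SOT p = subtopology (product_topology (\<lambda>_. lp_topology p) (lp p)) (lp_operators p)"

definition lp_SOT_star :: "real \<Rightarrow> ((nat \<Rightarrow> complex) \<Rightarrow> (nat \<Rightarrow> complex)) topology" where
  "lp_SOT_star p = pullback_topology (lp_operators p) (\<lambda>T. (T, lp_adjoint p T))
     (prod_topology (product_topology (\<lambda>_. lp_topology p) (lp p))
                    (product_topology (\<lambda>_. lp_dual_topology p) (lp_dual p)))"


section \<open>Basic facts\<close>

lemma powr_convex_combination: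
  fixes p s t u v :: real
  assumes p: "p \<ge> 1" and s: "s \<ge> 0" and t: "t \<ge> 0" and u: "u > 0" and v: "v > 0" and uv: "u + v = 1"
  shows "(u * s + v * t) powr p \<le> u * s powr p + v * t powr p"
proof -
  have small: "w powr p \<le> w" if "w > 0" "w \<le> 1" for w :: real
    using powr_mono'[of 1 p w] that p by simp
  consider "s = 0" | "t = 0" | "s > 0" "t > 0" using s t by linarith
  then show ?thesis
  proof cases
    case 1
    then show ?thesis using small[of v] u v uv t p
      by (simp add: powr_mult mult_right_mono)
  next
    case 2
    then show ?thesis using small[of u] u v uv s p
      by (simp add: powr_mult mult_right_mono)
  next
    case 3
    have "convex_on {0<..} (\<lambda>x::real. x powr p)" by (rule powr_convex[OF p])
    then show ?thesis
      using convex_onD[of "{0<..}" "\<lambda>x::real. x powr p" v s t] 3 u v uv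
      by (simp add: eq_diff_eq[symmetric])
  qed
qed

lemma lp_norm_nonneg [simp]: "0 \<le> lp_norm p x"
  by (simp add: lp_norm_def)

lemma lp_norm_powr: "p > 0 \<Longrightarrow> x \<in> lp p \<Longrightarrow> lp_norm p x powr p = (\<Sum>n. norm (x n) powr p)"
  by (simp add: lp_norm_def lp_def powr_powr suminf_nonneg)

lemma lp_norm_zero: "p > 0 \<Longrightarrow> lp_norm p (\<lambda>_. 0) = 0"
  by (simp add: lp_norm_def)

lemma zero_in_lp: "(\<lambda>_. 0) \<in> lp p"
  by (simp add: lp_def)

lemma lp_norm_eq_0: "p > 0 \<Longrightarrow> x \<in> lp p \<Longrightarrow> lp_norm p x = 0 \<longleftrightarrow> x = (\<lambda>_. 0)"
  by (auto simp: lp_norm_def lp_def suminf_eq_zero_iff fun_eq_iff)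

lemma lp_scale: "x \<in> lp p \<Longrightarrow> (\<lambda>n. c * x n) \<in> lp p"
  by (simp add: lp_def norm_mult powr_mult summable_mult)

lemma lp_norm_scale: "p > 0 \<Longrightarrow> x \<in> lp p \<Longrightarrow> lp_norm p (\<lambda>n. c * x n) = norm c * lp_norm p x"
  by (simp add: lp_norm_def lp_def norm_mult powr_mult suminf_mult powr_powr suminf_nonneg)

lemma lp_norm_minus_commute: "lp_norm p (\<lambda>n. x n - y n) = lp_norm p (\<lambda>n. y n - x n)"
  by (simp add: lp_norm_def norm_minus_commute)

lemma lp_add_triangle:
  assumes p: "p \<ge> 1" and x: "x \<in> lp p" and y: "y \<in> lp p"
  shows "(\<lambda>n. x n + y n) \<in> lp p \<and> lp_norm p (\<lambda>n. x n + y n) \<le> lp_norm p x + lp_norm p y"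
proof -
  let ?a = "lp_norm p x" and ?b = "lp_norm p y"
  have p0: "p > 0" using p by simp
  consider "?a = 0" | "?b = 0" | "?a > 0" "?b > 0"
    using lp_norm_nonneg[of p x] lp_norm_nonneg[of p y] by linarith
  then show ?thesis
  proof cases
    case 1
    then show ?thesis using lp_norm_eq_0[OF p0 x] y by simp
  next
    case 2
    then show ?thesis using lp_norm_eq_0[OF p0 y] x by simp
  next
    case 3
    define c where "c = ?a + ?b"
    have c: "c > 0" using 3 by (simp add: c_def)
    let ?g = "\<lambda>n. c powr p * (?a / c * (norm (x n) powr p / ?a powr p)
                             + ?b / c * (norm (y n) powr p / ?b powr p))"
    have sx: "(\<lambda>n. norm (x n) powr p) sums (?a powr p)"
      and sy: "(\<lambda>n. norm (y n) powr p) sums (?b powr p)"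
      using x y by (simp_all add: lp_norm_powr[OF p0] lp_def summable_sums)
    have "?g sums (c powr p * (?a / c * (?a powr p / ?a powr p) + ?b / c * (?b powr p / ?b powr p)))"
      by (intro sums_mult sums_add sums_divide sx sy)
    moreover have "?a / c * (?a powr p / ?a powr p) + ?b / c * (?b powr p / ?b powr p) = 1"
      using 3 c by (simp add: c_def add_divide_distrib[symmetric])
    ultimately have g: "?g sums (c powr p)" by simp
    have le: "norm (x n + y n) powr p \<le> ?g n" for n
    proof -
      have "norm (x n + y n) \<le> c * (?a / c * (norm (x n) / ?a) + ?b / c * (norm (y n) / ?b))"
        using 3 c norm_triangle_ineq[of "x n" "y n"] by (simp add: distrib_left)
      then have "norm (x n + y n) powr p
          \<le> (c * (?a / c * (norm (x n) / ?a) + ?b / c * (norm (y n) / ?b))) powr p"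
        using p0 by (intro powr_mono2) auto
      also have "\<dots> = c powr p * (?a / c * (norm (x n) / ?a) + ?b / c * (norm (y n) / ?b)) powr p"
        using 3 c by (intro powr_mult)
      also have "\<dots> \<le> c powr p * (?a / c * (norm (x n) / ?a) powr p + ?b / c * (norm (y n) / ?b) powr p)"
        using 3 c by (intro mult_left_mono powr_convex_combination[OF p])
          (auto simp: c_def add_divide_distrib[symmetric])
      finally show ?thesis using 3 by (simp add: powr_divide)
    qed
    have sm: "summable (\<lambda>n. norm (x n + y n) powr p)"
      by (rule summable_comparison_test'[OF sums_summable[OF g], of 0]) (use le in auto)
    then have mem: "(\<lambda>n. x n + y n) \<in> lp p" by (simp add: lp_def)
    have "(\<Sum>n. norm (x n + y n) powr p) \<le> (\<Sum>n. ?g n)"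
      by (rule suminf_le[OF le sm sums_summable[OF g]])
    then have "(\<Sum>n. norm (x n + y n) powr p) \<le> c powr p"
      using sums_unique[OF g] by simp
    then have "lp_norm p (\<lambda>n. x n + y n) \<le> (c powr p) powr (1 / p)"
      unfolding lp_norm_def using p0 sm by (intro powr_mono2 suminf_nonneg) auto
    then show ?thesis using mem c p0 by (simp add: powr_powr c_def)
  qed
qed

lemma lp_diff: "p \<ge> 1 \<Longrightarrow> x \<in> lp p \<Longrightarrow> y \<in> lp p \<Longrightarrow> (\<lambda>n. x n - y n) \<in> lp p"
  using lp_add_triangle[of p x "\<lambda>n. - 1 * y n"] lp_scale[of y p "- 1"] by simp

lemma Metric_space_lp:
  assumes p: "p \<ge> 1"
  shows "Metric_space (lp p) (lp_dist p)"
proof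
  show "lp_dist p x y = 0 \<longleftrightarrow> x = y" if "x \<in> lp p" "y \<in> lp p" for x y
    using lp_norm_eq_0[OF _ lp_diff[OF p that]] p by (auto simp: lp_dist_def fun_eq_iff)
  show "lp_dist p x z \<le> lp_dist p x y + lp_dist p y z"
    if "x \<in> lp p" "y \<in> lp p" "z \<in> lp p" for x y z
    using lp_add_triangle[OF p lp_diff[OF p that(1,2)] lp_diff[OF p that(2,3)]]
    by (simp add: lp_dist_def)
qed (simp_all add: lp_dist_def, rule lp_norm_minus_commute)

lemma lp_dual_diff:
  assumes p: "p \<ge> 1" and "\<phi> \<in> lp_dual p" "\<psi> \<in> lp_dual p"
  shows "(\<lambda>x\<in>lp p. \<phi> x - \<psi> x) \<in> lp_dual p"
proof -
  obtain K L where K: "\<forall>x\<in>lp p. norm (\<phi> x) \<le> K * lp_norm p x"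
    and L: "\<forall>x\<in>lp p. norm (\<psi> x) \<le> L * lp_norm p x"
    using assms by (auto simp: lp_dual_def)
  have "norm (\<phi> x - \<psi> x) \<le> (K + L) * lp_norm p x" if "x \<in> lp p" for x
    using K L that norm_triangle_ineq4[of "\<phi> x" "\<psi> x"] by (fastforce simp: distrib_right)
  then show ?thesis
    using assms by (auto simp: lp_dual_def lp_scale lp_add_triangle algebra_simps intro!: exI[of _ "K + L"])
qed

lemma lp_dual_bdd_above:
  assumes "\<phi> \<in> lp_dual p"
  shows "bdd_above ((\<lambda>x. norm (\<phi> x)) ` {x \<in> lp p. lp_norm p x \<le> 1})"
proof -
  obtain K where K: "\<forall>x\<in>lp p. norm (\<phi> x) \<le> K * lp_norm p x"
    using assms by (auto simp: lp_dual_def)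
  have "norm (\<phi> x) \<le> \<bar>K\<bar>" if "x \<in> lp p" "lp_norm p x \<le> 1" for x
  proof -
    have "norm (\<phi> x) \<le> K * lp_norm p x" using K that by blast
    also have "\<dots> \<le> \<bar>K\<bar> * lp_norm p x" by (simp add: mult_right_mono)
    also have "\<dots> \<le> \<bar>K\<bar>" using that by (simp add: mult_left_le)
    finally show ?thesis .
  qed
  then show ?thesis by (auto simp: bdd_above_def)
qed

lemma lp_dual_norm_restrict: "lp_dual_norm p (\<lambda>x\<in>lp p. f x) = lp_dual_norm p f"
  unfolding lp_dual_norm_def by (rule SUP_cong) auto

lemma lp_dual_norm_upper:
  "\<phi> \<in> lp_dual p \<Longrightarrow> x \<in> lp p \<Longrightarrow> lp_norm p x \<le> 1 \<Longrightarrow> norm (\<phi> x) \<le> lp_dual_norm p \<phi>"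
  unfolding lp_dual_norm_def by (rule cSUP_upper[OF _ lp_dual_bdd_above]) auto

lemma lp_dual_norm_nonneg: "p > 0 \<Longrightarrow> \<phi> \<in> lp_dual p \<Longrightarrow> 0 \<le> lp_dual_norm p \<phi>"
  by (rule order_trans[OF norm_ge_zero lp_dual_norm_upper[OF _ zero_in_lp]])
    (simp_all add: lp_norm_zero)

lemma lp_dual_norm_bound:
  assumes p: "p \<ge> 1" and f: "\<phi> \<in> lp_dual p" and x: "x \<in> lp p"
  shows "norm (\<phi> x) \<le> lp_dual_norm p \<phi> * lp_norm p x"
proof (cases "lp_norm p x = 0")
  case True
  obtain K where "\<forall>x\<in>lp p. norm (\<phi> x) \<le> K * lp_norm p x"
    using f by (auto simp: lp_dual_def)
  then show ?thesis using True x by fastforce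
next
  case False
  let ?a = "lp_norm p x"
  have a: "?a > 0" using False lp_norm_nonneg[of p x] by linarith
  have "lp_norm p (\<lambda>n. of_real (1 / ?a) * x n) = norm (complex_of_real (1 / ?a)) * ?a"
    using p x by (intro lp_norm_scale) auto
  then have "lp_norm p (\<lambda>n. of_real (1 / ?a) * x n) \<le> 1" using a by (simp add: norm_divide)
  then have "norm (\<phi> (\<lambda>n. of_real (1 / ?a) * x n)) \<le> lp_dual_norm p \<phi>"
    using lp_dual_norm_upper[OF f lp_scale[OF x]] by blast
  also have "\<phi> (\<lambda>n. of_real (1 / ?a) * x n) = of_real (1 / ?a) * \<phi> x"
    using f x unfolding lp_dual_def by blast
  finally show ?thesis using a by (simp add: norm_mult norm_divide divide_le_eq)
qed

lemma lp_dual_norm_triangle: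
  assumes "p \<ge> 1" "\<phi> \<in> lp_dual p" "\<psi> \<in> lp_dual p" "\<And>x. x \<in> lp p \<Longrightarrow> norm (f x) \<le> norm (\<phi> x) + norm (\<psi> x)"
  shows "lp_dual_norm p f \<le> lp_dual_norm p \<phi> + lp_dual_norm p \<psi>"
proof -
  have ne: "{x \<in> lp p. lp_norm p x \<le> 1} \<noteq> {}"
    using zero_in_lp[of p] lp_norm_zero[of p] assms(1) by force
  show ?thesis
    unfolding lp_dual_norm_def[of p f]
    using assms lp_dual_norm_upper[OF assms(2)] lp_dual_norm_upper[OF assms(3)]
    by (intro cSUP_least[OF ne]) fastforce
qed

lemma Metric_space_lp_dual:
  assumes p: "p \<ge> 1"
  shows "Metric_space (lp_dual p) (lp_dual_dist p)"
proof
  have p0: "p > 0" using p by simp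
  have nn: "0 \<le> lp_dual_norm p (\<lambda>x. \<phi> x - \<psi> x)" if "\<phi> \<in> lp_dual p" "\<psi> \<in> lp_dual p" for \<phi> \<psi>
    using lp_dual_norm_nonneg[OF p0 lp_dual_diff[OF p that]] by (simp add: lp_dual_norm_restrict)
  then show "0 \<le> lp_dual_dist p \<phi> \<psi>" for \<phi> \<psi>
    by (simp add: lp_dual_dist_def)
  show "lp_dual_dist p \<phi> \<psi> = lp_dual_dist p \<psi> \<phi>" for \<phi> \<psi>
    by (simp add: lp_dual_dist_def lp_dual_norm_def norm_minus_commute)
  show "lp_dual_dist p \<phi> \<psi> = 0 \<longleftrightarrow> \<phi> = \<psi>" if f: "\<phi> \<in> lp_dual p" and g: "\<psi> \<in> lp_dual p" for \<phi> \<psi>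
  proof
    assume "lp_dual_dist p \<phi> \<psi> = 0"
    then have 0: "lp_dual_norm p (\<lambda>x\<in>lp p. \<phi> x - \<psi> x) = 0"
      using that by (simp add: lp_dual_dist_def lp_dual_norm_restrict)
    have "\<phi> x = \<psi> x" if "x \<in> lp p" for x
      using lp_dual_norm_bound[OF p lp_dual_diff[OF p f g] that] 0 that by simp
    then show "\<phi> = \<psi>"
      using f g by (intro extensionalityI[of _ "lp p"]) (auto simp: lp_dual_def)
  next
    have "(\<lambda>x. 0) ` {x \<in> lp p. lp_norm p x \<le> 1} = {0::real}"
      using zero_in_lp[of p] lp_norm_zero[OF p0] by force
    then show "\<phi> = \<psi> \<Longrightarrow> lp_dual_dist p \<phi> \<psi> = 0"
      by (simp add: lp_dual_dist_def lp_dual_norm_def)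
  qed
  show "lp_dual_dist p \<phi> \<xi> \<le> lp_dual_dist p \<phi> \<psi> + lp_dual_dist p \<psi> \<xi>"
    if f: "\<phi> \<in> lp_dual p" and g: "\<psi> \<in> lp_dual p" and h: "\<xi> \<in> lp_dual p" for \<phi> \<psi> \<xi>
  proof -
    have "lp_dual_norm p (\<lambda>x. \<phi> x - \<xi> x)
        \<le> lp_dual_norm p (\<lambda>x\<in>lp p. \<phi> x - \<psi> x) + lp_dual_norm p (\<lambda>x\<in>lp p. \<psi> x - \<xi> x)"
    proof (rule lp_dual_norm_triangle[OF p lp_dual_diff[OF p f g] lp_dual_diff[OF p g h]])
      fix x assume "x \<in> lp p"
      then show "norm (\<phi> x - \<xi> x)
          \<le> norm ((\<lambda>x\<in>lp p. \<phi> x - \<psi> x) x) + norm ((\<lambda>x\<in>lp p. \<psi> x - \<xi> x) x)"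
        using norm_triangle_ineq[of "\<phi> x - \<psi> x" "\<psi> x - \<xi> x"] by simp
    qed
    then show ?thesis using that by (simp add: lp_dual_dist_def lp_dual_norm_restrict)
  qed
qed

lemma topspace_lp_topology: "p \<ge> 1 \<Longrightarrow> topspace (lp_topology p) = lp p"
  by (simp add: lp_topology_def Metric_space.topspace_mtopology Metric_space_lp)

lemma topspace_lp_dual_topology: "p \<ge> 1 \<Longrightarrow> topspace (lp_dual_topology p) = lp_dual p"
  by (simp add: lp_dual_topology_def Metric_space.topspace_mtopology Metric_space_lp_dual)

lemma lp_adjoint_in_dual:
  assumes p: "p \<ge> 1" and T: "T \<in> lp_operators p" and f: "\<phi> \<in> lp_dual p"
  shows "lp_adjoint p T \<phi> \<in> lp_dual p"
proof -
  have Tm: "T x \<in> lp p" if "x \<in> lp p" for x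
    using T that by (auto simp: lp_operators_def)
  obtain K where K: "\<And>x. x \<in> lp p \<Longrightarrow> lp_norm p (T x) \<le> K * lp_norm p x"
    using T unfolding lp_operators_def by blast
  have "norm (\<phi> (T x)) \<le> (lp_dual_norm p \<phi> * K) * lp_norm p x" if "x \<in> lp p" for x
  proof -
    have "norm (\<phi> (T x)) \<le> lp_dual_norm p \<phi> * lp_norm p (T x)"
      by (rule lp_dual_norm_bound[OF p f Tm[OF that]])
    also have "\<dots> \<le> lp_dual_norm p \<phi> * (K * lp_norm p x)"
      using p by (intro mult_left_mono K[OF that] lp_dual_norm_nonneg[OF _ f]) simp
    finally show ?thesis by (simp add: mult.assoc)
  qed
  moreover have "\<phi> (T (\<lambda>n. x n + y n)) = \<phi> (T x) + \<phi> (T y)" if "x \<in> lp p" "y \<in> lp p" for x y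
    using T f that Tm by (simp add: lp_operators_def lp_dual_def)
  moreover have "\<phi> (T (\<lambda>n. c * x n)) = c * \<phi> (T x)" if "x \<in> lp p" for c x
    using T f that Tm by (simp add: lp_operators_def lp_dual_def)
  ultimately have "(\<lambda>x\<in>lp p. \<phi> (T x)) \<in> lp_dual p"
    using p by (auto simp: lp_dual_def lp_scale lp_add_triangle)
  then show ?thesis using f by (simp add: lp_adjoint_def)
qed

lemma lp_operators_subset: "p \<ge> 1 \<Longrightarrow>
    lp_operators p \<subseteq> topspace (product_topology (\<lambda>_. lp_topology p) (lp p))"
  by (auto simp: lp_operators_def topspace_lp_topology)

lemma topspace_lp_SOT: "p \<ge> 1 \<Longrightarrow> topspace (lp_SOT p) = lp_operators p"
  using lp_operators_subset by (auto simp: lp_SOT_def)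

lemma lp_adjoint_in_topspace: "p \<ge> 1 \<Longrightarrow> T \<in> lp_operators p \<Longrightarrow>
    lp_adjoint p T \<in> topspace (product_topology (\<lambda>_. lp_dual_topology p) (lp_dual p))"
  using lp_adjoint_in_dual by (auto simp: topspace_lp_dual_topology) (simp add: lp_adjoint_def)

lemma topspace_lp_SOT_star: "p \<ge> 1 \<Longrightarrow> topspace (lp_SOT_star p) = lp_operators p"
  using lp_operators_subset lp_adjoint_in_topspace
  by (fastforce simp: lp_SOT_star_def topspace_pullback_topology)

lemma limitin_pullback_topology:
  assumes "\<And>a. a \<in> A \<Longrightarrow> f a \<in> topspace Y"
  shows "limitin (pullback_topology A f Y) g l F \<longleftrightarrow>
    l \<in> A \<and> (\<forall>\<^sub>F i in F. g i \<in> A) \<and> limitin Y (\<lambda>i. f (g i)) (f l) F"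
proof
  assume L: "limitin (pullback_topology A f Y) g l F"
  then have l: "l \<in> A" by (auto simp: limitin_def topspace_pullback_topology)
  have ev: "\<forall>\<^sub>F i in F. f (g i) \<in> U \<and> g i \<in> A" if "openin Y U" "f l \<in> U" for U
  proof -
    have "openin (pullback_topology A f Y) (f -` U \<inter> A)" "l \<in> f -` U \<inter> A"
      using that l by (auto simp: openin_pullback_topology)
    then have "\<forall>\<^sub>F i in F. g i \<in> f -` U \<inter> A" using L unfolding limitin_def by blast
    then show ?thesis by (rule eventually_mono) blast
  qed
  have "\<forall>\<^sub>F i in F. g i \<in> A"
    using ev[OF openin_topspace assms[OF l]] by (rule eventually_mono) blast
  moreover have "limitin Y (\<lambda>i. f (g i)) (f l) F"
    unfolding limitin_def using assms[OF l] ev by (blast intro: eventually_mono)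
  ultimately show "l \<in> A \<and> (\<forall>\<^sub>F i in F. g i \<in> A) \<and> limitin Y (\<lambda>i. f (g i)) (f l) F"
    using l by blast
next
  assume R: "l \<in> A \<and> (\<forall>\<^sub>F i in F. g i \<in> A) \<and> limitin Y (\<lambda>i. f (g i)) (f l) F"
  then show "limitin (pullback_topology A f Y) g l F"
    using assms unfolding limitin_def topspace_pullback_topology openin_pullback_topology
    by (auto elim: eventually_elim2)
qed

lemma limitin_lp_topology:
  assumes p: "p \<ge> 1" and "l \<in> lp p" "\<forall>\<^sub>F i in F. g i \<in> lp p"
  shows "limitin (lp_topology p) g l F \<longleftrightarrow> ((\<lambda>i. lp_norm p (\<lambda>n. g i n - l n)) \<longlongrightarrow> 0) F"
proof -
  interpret Metric_space "lp p" "lp_dist p" by (rule Metric_space_lp[OF p])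
  show ?thesis using assms
    by (auto simp: lp_topology_def limitin_metric_dist_null lp_dist_def)
qed

lemma limitin_lp_dual_topology:
  assumes p: "p \<ge> 1" and l: "l \<in> lp_dual p" and g: "\<forall>\<^sub>F i in F. g i \<in> lp_dual p"
  shows "limitin (lp_dual_topology p) g l F \<longleftrightarrow> ((\<lambda>i. lp_dual_norm p (\<lambda>x. g i x - l x)) \<longlongrightarrow> 0) F"
proof -
  interpret Metric_space "lp_dual p" "lp_dual_dist p" by (rule Metric_space_lp_dual[OF p])
  have "\<forall>\<^sub>F i in F. lp_dual_dist p (g i) l = lp_dual_norm p (\<lambda>x. g i x - l x)"
    using g by (rule eventually_mono) (simp add: lp_dual_dist_def l)
  then show ?thesis using l g
    by (auto simp: lp_dual_topology_def limitin_metric_dist_null tendsto_cong)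
qed

lemma limitin_lp_pointwise:
  assumes p: "p \<ge> 1" and T: "T \<in> lp_operators p" and S: "\<forall>\<^sub>F i in F. S i \<in> lp_operators p"
  shows "limitin (product_topology (\<lambda>_. lp_topology p) (lp p)) S T F \<longleftrightarrow>
    (\<forall>x\<in>lp p. ((\<lambda>i. lp_norm p (\<lambda>n. S i x n - T x n)) \<longlongrightarrow> 0) F)"
proof -
  have sub: "S \<in> lp_operators p \<Longrightarrow> S \<in> extensional (lp p) \<and> (\<forall>x\<in>lp p. S x \<in> lp p)" for S
    by (auto simp: lp_operators_def PiE_def)
  have "\<forall>\<^sub>F i in F. S i \<in> topspace (product_topology (\<lambda>_. lp_topology p) (lp p))"
    using S by (rule eventually_mono) (use lp_operators_subset[OF p] in blast)
  moreover have "\<forall>\<^sub>F i in F. S i x \<in> lp p" if "x \<in> lp p" for x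
    using S by (rule eventually_mono) (use sub that in blast)
  ultimately show ?thesis
    using sub[OF T] by (simp add: limitin_componentwise limitin_lp_topology[OF p])
qed

lemma limitin_lp_SOT:
  assumes p: "p \<ge> 1"
  shows "limitin (lp_SOT p) S T F \<longleftrightarrow>
    T \<in> lp_operators p \<and> (\<forall>\<^sub>F i in F. S i \<in> lp_operators p) \<and>
    (\<forall>x\<in>lp p. ((\<lambda>i. lp_norm p (\<lambda>n. S i x n - T x n)) \<longlongrightarrow> 0) F)"
  using limitin_lp_pointwise[OF p] by (auto simp: lp_SOT_def limitin_subtopology)

lemma limitin_lp_SOT_star:
  assumes p: "p \<ge> 1"
  shows "limitin (lp_SOT_star p) S T F \<longleftrightarrow>
    T \<in> lp_operators p \<and> (\<forall>\<^sub>F i in F. S i \<in> lp_operators p) \<and>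
    (\<forall>x\<in>lp p. ((\<lambda>i. lp_norm p (\<lambda>n. S i x n - T x n)) \<longlongrightarrow> 0) F) \<and>
    (\<forall>\<phi>\<in>lp_dual p.
       ((\<lambda>i. lp_dual_norm p (\<lambda>x. lp_adjoint p (S i) \<phi> x - lp_adjoint p T \<phi> x)) \<longlongrightarrow> 0) F)"
proof -
  have adj: "limitin (product_topology (\<lambda>_. lp_dual_topology p) (lp_dual p))
        (\<lambda>i. lp_adjoint p (S i)) (lp_adjoint p T) F \<longleftrightarrow>
      (\<forall>\<phi>\<in>lp_dual p.
       ((\<lambda>i. lp_dual_norm p (\<lambda>x. lp_adjoint p (S i) \<phi> x - lp_adjoint p T \<phi> x)) \<longlongrightarrow> 0) F)"
    if T: "T \<in> lp_operators p" and S: "\<forall>\<^sub>F i in F. S i \<in> lp_operators p"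
  proof -
    have "\<forall>\<^sub>F i in F. lp_adjoint p (S i) \<in> topspace (product_topology (\<lambda>_. lp_dual_topology p) (lp_dual p))"
      using S by (rule eventually_mono) (rule lp_adjoint_in_topspace[OF p])
    moreover have "\<forall>\<^sub>F i in F. lp_adjoint p (S i) \<phi> \<in> lp_dual p" if "\<phi> \<in> lp_dual p" for \<phi>
      using S by (rule eventually_mono) (rule lp_adjoint_in_dual[OF p _ that])
    moreover have "lp_adjoint p T \<in> extensional (lp_dual p)" by (simp add: lp_adjoint_def)
    ultimately show ?thesis
      using lp_adjoint_in_dual[OF p T]
      by (simp add: limitin_componentwise limitin_lp_dual_topology[OF p])
  qed
  have "(T, lp_adjoint p T) \<in> topspace (prod_topology (product_topology (\<lambda>_. lp_topology p) (lp p))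
          (product_topology (\<lambda>_. lp_dual_topology p) (lp_dual p)))" if "T \<in> lp_operators p" for T
    using lp_operators_subset[OF p] lp_adjoint_in_topspace[OF p that] that
    unfolding topspace_prod_topology by blast
  then show ?thesis
    unfolding lp_SOT_star_def
    by (subst limitin_pullback_topology)
      (auto simp: limitin_pairwise o_def limitin_lp_pointwise[OF p] adj)
qed

end

theory Submission
  imports Defs
begin

text \<open>
  For \<open>p > 2\<close>, if \<open>S\<close> is a contraction, \<open>x\<close> and \<open>y\<close> are disjointly supported unit vectors and
  \<open>\<parallel>S x\<parallel>\<close> is close to \<open>1\<close>, then averaging \<open>\<parallel>S x \<plusminus> t S y\<parallel>\<^sup>p \<le> 1 + t\<^sup>p\<close> shows that \<open>t\<^sup>2 \<bar>(S x)\<^sub>j\<bar>\<^bsup>p-2\<^esup> \<bar>(S y)\<^sub>j\<bar>\<^sup>2\<close>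
  is at most about \<open>t\<^sup>p\<close>, so that \<open>(S y)\<^sub>j\<close> is small wherever \<open>(S x)\<^sub>j\<close> is not. Hence if \<open>B\<close> almost
  attains its norm \<open>1\<close> at some \<open>x\<close> of finite support for which the first coordinates of \<open>B x\<close> stay
  away from \<open>0\<close>, then a contraction that is SOT-close to \<open>B\<close> has its first rows norm-close to those
  of \<open>B\<close>. Such \<open>B\<close> are SOT*-dense: truncate \<open>T\<close> to a \<open>K \<times> K\<close> block of norm less than \<open>1\<close>, add a
  column \<open>(w, 1)\<close> with small \<open>w\<close>, and normalise. With the other entries of \<open>w\<close> fixed, at most one
  value of \<open>w\<^sub>j\<close> is bad for the \<open>j\<close>-th coordinate, so a good \<open>w\<close> exists on a grid with \<open>K + 1\<close> values
  per entry by counting.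
\<close>

section \<open>Truncations\<close>

lemma lp_dominated:
  assumes p: "p > 0" and y: "y \<in> lp p" and le: "\<And>n. norm (x n) \<le> norm (y n)"
  shows "x \<in> lp p" and "lp_norm p x \<le> lp_norm p y"
proof -
  have le': "norm (x n) powr p \<le> norm (y n) powr p" for n
    using le p by (intro powr_mono2) auto
  have sy: "summable (\<lambda>n. norm (y n) powr p)" using y by (simp add: lp_def)
  have sx: "summable (\<lambda>n. norm (x n) powr p)"
    by (rule summable_comparison_test'[OF sy, of 0]) (use le' in auto)
  then show "x \<in> lp p" by (simp add: lp_def)
  show "lp_norm p x \<le> lp_norm p y"
    unfolding lp_norm_def using p
    by (intro powr_mono2 suminf_le sx sy le' suminf_nonneg) auto
qed

lemma lp_norm_le_iff_powr:
  assumes "p > 0" "c \<ge> 0" shows "lp_norm p x \<le> c \<longleftrightarrow> lp_norm p x powr p \<le> c powr p"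
  using assms powr_less_mono2[of p c "lp_norm p x"] powr_mono2[of p "lp_norm p x" c] by fastforce

definition lp_cut :: "nat \<Rightarrow> (nat \<Rightarrow> complex) \<Rightarrow> nat \<Rightarrow> complex" where
  "lp_cut m x = (\<lambda>n. if n < m then x n else 0)"

definition lp_unit :: "nat \<Rightarrow> nat \<Rightarrow> complex" where
  "lp_unit i = (\<lambda>n. if n = i then 1 else 0)"

lemma lp_cut_in: "lp_cut m x \<in> lp p"
proof -
  have "summable (\<lambda>n. norm (lp_cut m x n) powr p)"
    by (rule summable_finite[of "{..<m}"]) (auto simp: lp_cut_def)
  then show ?thesis by (simp add: lp_def)
qed

lemma lp_unit_in: "lp_unit i \<in> lp p"
proof -
  have "lp_unit i = lp_cut (Suc i) (lp_unit i)" by (auto simp: lp_cut_def lp_unit_def)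
  then show ?thesis by (metis lp_cut_in)
qed

lemma lp_norm_unit: "p > 0 \<Longrightarrow> lp_norm p (lp_unit i) = 1"
proof -
  assume "p > 0"
  have "(\<lambda>n. norm (lp_unit i n) powr p) = (\<lambda>n. if n = i then 1 else 0)"
    by (auto simp: lp_unit_def)
  moreover have "(\<Sum>n. if n = i then 1 else 0) = (1::real)"
    by (subst suminf_finite[of "{i}"]) auto
  ultimately show ?thesis by (simp add: lp_norm_def)
qed

lemma lp_norm_cut_le: "p > 0 \<Longrightarrow> x \<in> lp p \<Longrightarrow> lp_norm p (lp_cut m x) \<le> lp_norm p x"
  by (rule lp_dominated) (auto simp: lp_cut_def)

lemma lp_norm_tail_le: "p > 0 \<Longrightarrow> x \<in> lp p \<Longrightarrow> lp_norm p (\<lambda>n. x n - lp_cut m x n) \<le> lp_norm p x"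
  by (rule lp_dominated) (auto simp: lp_cut_def)

lemma lp_tail_in: "p \<ge> 1 \<Longrightarrow> x \<in> lp p \<Longrightarrow> (\<lambda>n. x n - lp_cut m x n) \<in> lp p"
  by (intro lp_diff lp_cut_in)

lemma lp_norm_coord: "p > 0 \<Longrightarrow> x \<in> lp p \<Longrightarrow> norm (x n) \<le> lp_norm p x"
proof -
  assume p: "p > 0" and x: "x \<in> lp p"
  have "lp_norm p (\<lambda>k. x n * lp_unit n k) \<le> lp_norm p x"
    by (rule lp_dominated[OF p x]) (auto simp: lp_unit_def)
  then show ?thesis by (simp add: lp_norm_scale[OF p lp_unit_in] lp_norm_unit[OF p])
qed

lemma lp_cut_Suc: "lp_cut (Suc m) x = (\<lambda>n. lp_cut m x n + x m * lp_unit m n)"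
  by (auto simp: lp_cut_def lp_unit_def fun_eq_iff less_Suc_eq)

lemma lp_cut_0: "lp_cut 0 x = (\<lambda>_. 0)"
  by (simp add: lp_cut_def)

text \<open>A crude bound, by the triangle inequality over unit vectors. It suffices because it only
  serves to keep the added column \<open>w\<close> small.\<close>

lemma lp_norm_cut_sum:
  assumes p: "p \<ge> 1"
  shows "lp_norm p (lp_cut m x) \<le> (\<Sum>n<m. norm (x n))"
proof (induction m)
  case 0
  then show ?case using p by (simp add: lp_cut_0 lp_norm_zero)
next
  case (Suc m)
  have "lp_norm p (lp_cut (Suc m) x) \<le> lp_norm p (lp_cut m x) + lp_norm p (\<lambda>n. x m * lp_unit m n)"
    unfolding lp_cut_Suc using lp_add_triangle[OF p lp_cut_in lp_scale[OF lp_unit_in]] by blast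
  then show ?case using Suc p by (simp add: lp_norm_scale lp_unit_in lp_norm_unit)
qed

text \<open>At each index one of the two terms vanishes, so the \<open>p\<close>-th powers add
  termwise. All bounds of the form \<open>1 + t powr p\<close> come from here.\<close>

lemma lp_norm_disjoint:
  assumes p: "p > 0" and x: "x \<in> lp p" and y: "y \<in> lp p" and d: "\<And>n. x n = 0 \<or> y n = 0"
  shows "(\<lambda>n. x n + y n) \<in> lp p"
    and "lp_norm p (\<lambda>n. x n + y n) powr p = lp_norm p x powr p + lp_norm p y powr p"
proof -
  have e: "norm (x n + y n) powr p = norm (x n) powr p + norm (y n) powr p" for n
    using d[of n] by auto
  have sx: "summable (\<lambda>n. norm (x n) powr p)" and sy: "summable (\<lambda>n. norm (y n) powr p)"
    using x y by (simp_all add: lp_def)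
  show m: "(\<lambda>n. x n + y n) \<in> lp p" using summable_add[OF sx sy] by (simp add: lp_def e)
  show "lp_norm p (\<lambda>n. x n + y n) powr p = lp_norm p x powr p + lp_norm p y powr p"
    using suminf_add[OF sx sy] by (simp add: lp_norm_powr[OF p] x y m e)
qed

text \<open>The two series differ in a single term. This compares the images of one vector under
  operators that differ in one matrix entry.\<close>

lemma lp_norm_powr_update:
  assumes p: "p > 0" and x: "x \<in> lp p" and y: "y \<in> lp p" and d: "\<And>n. n \<noteq> j \<Longrightarrow> x n = y n"
  shows "lp_norm p x powr p - norm (x j) powr p = lp_norm p y powr p - norm (y j) powr p"
proof -
  have sx: "summable (\<lambda>n. norm (x n) powr p)" and sy: "summable (\<lambda>n. norm (y n) powr p)"
    using x y by (simp_all add: lp_def)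
  have "lp_norm p x powr p - lp_norm p y powr p = (\<Sum>n. norm (x n) powr p - norm (y n) powr p)"
    using suminf_diff[OF sx sy] by (simp add: lp_norm_powr[OF p] x y)
  also have "\<dots> = (\<Sum>n\<in>{j}. norm (x n) powr p - norm (y n) powr p)"
    by (rule suminf_finite) (auto simp: d)
  finally show ?thesis by simp
qed

lemma lp_tail_tendsto:
  assumes p: "p > 0" and x: "x \<in> lp p"
  shows "(\<lambda>m. lp_norm p (\<lambda>n. x n - lp_cut m x n)) \<longlonglongrightarrow> 0"
proof -
  have sx: "summable (\<lambda>n. norm (x n) powr p)" using x by (simp add: lp_def)
  have e: "(\<Sum>n. norm (x n - lp_cut m x n) powr p) = (\<Sum>n. norm (x (n + m)) powr p)" for m
  proof -
    have "summable (\<lambda>n. norm (x n - lp_cut m x n) powr p)"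
      using lp_dominated(1)[OF p x, of "\<lambda>n. x n - lp_cut m x n"] by (auto simp: lp_def lp_cut_def)
    from suminf_split_initial_segment[OF this, of m] show ?thesis by (simp add: lp_cut_def)
  qed
  have "(\<lambda>m. \<Sum>n. norm (x (n + m)) powr p) \<longlonglongrightarrow> 0"
    by (rule suminf_exist_split2[OF sx])
  then have "(\<lambda>m. (\<Sum>n. norm (x (n + m)) powr p) powr (1 / p)) \<longlonglongrightarrow> 0 powr (1 / p)"
    using p by (intro tendsto_powr2)
      (auto intro!: always_eventually suminf_nonneg summable_ignore_initial_segment[OF sx])
  then show ?thesis using p by (simp add: lp_norm_def e)
qed

section \<open>Contractions\<close>

text \<open>Homogeneity carries the bound from the unit ball to all of \<open>lp p\<close>, which
  yields both the constant required by \<open>lp_operators\<close> and the bound on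
  \<open>lp_opnorm\<close>.\<close>

lemma lp_contractionI:
  assumes p: "p \<ge> 1"
    and m: "\<And>x. x \<in> lp p \<Longrightarrow> f x \<in> lp p"
    and a: "\<And>x y. x \<in> lp p \<Longrightarrow> y \<in> lp p \<Longrightarrow> f (\<lambda>n. x n + y n) = (\<lambda>n. f x n + f y n)"
    and s: "\<And>c x. x \<in> lp p \<Longrightarrow> f (\<lambda>n. c * x n) = (\<lambda>n. c * f x n)"
    and b: "\<And>x. x \<in> lp p \<Longrightarrow> lp_norm p x \<le> 1 \<Longrightarrow> lp_norm p (f x) \<le> 1"
  shows "restrict f (lp p) \<in> lp_contractions p"
proof -
  have bd: "lp_norm p (f x) \<le> lp_norm p x" if x: "x \<in> lp p" for x
  proof (cases "lp_norm p x = 0")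
    case True
    then have "x = (\<lambda>_. 0)" using lp_norm_eq_0[of p x] p x by simp
    moreover have "f (\<lambda>_. 0) = (\<lambda>_. 0)" using s[OF zero_in_lp, of 0] by simp
    ultimately show ?thesis by simp
  next
    case False
    then have q: "lp_norm p x > 0" using lp_norm_nonneg[of p x] by linarith
    let ?c = "complex_of_real (1 / lp_norm p x)"
    have nc: "norm ?c = 1 / lp_norm p x" using q by (simp add: norm_divide)
    have "lp_norm p (f (\<lambda>n. ?c * x n)) \<le> 1"
      using p q by (intro b lp_scale[OF x]) (simp add: lp_norm_scale[OF _ x] nc del: of_real_divide)
    then have "1 / lp_norm p x * lp_norm p (f x) \<le> 1"
      using p by (simp add: s[OF x] lp_norm_scale[OF _ m[OF x]] nc del: of_real_divide)
    then show ?thesis using q by (simp add: field_simps)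
  qed
  have "restrict f (lp p) \<in> lp_operators p"
    using p unfolding lp_operators_def
    by (auto simp: m a s lp_scale lp_add_triangle bd intro!: exI[of _ 1])
  moreover have "lp_opnorm p (restrict f (lp p)) \<le> 1"
    unfolding lp_opnorm_def
  proof (rule cSUP_least)
    show "{x \<in> lp p. lp_norm p x \<le> 1} \<noteq> {}"
      using zero_in_lp[of p] lp_norm_zero[of p] p by force
  qed (use b in auto)
  ultimately show ?thesis by (simp add: lp_contractions_def)
qed

lemma lp_contractionD:
  assumes "T \<in> lp_contractions p"
  shows "T \<in> lp_operators p"
    and "x \<in> lp p \<Longrightarrow> T x \<in> lp p"
    and "x \<in> lp p \<Longrightarrow> y \<in> lp p \<Longrightarrow> T (\<lambda>n. x n + y n) = (\<lambda>n. T x n + T y n)"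
    and "x \<in> lp p \<Longrightarrow> T (\<lambda>n. c * x n) = (\<lambda>n. c * T x n)"
  using assms by (auto simp: lp_contractions_def lp_operators_def)

text \<open>A real supremum dominates its members only if they are bounded above; the constant
  \<open>K\<close> from \<open>lp_operators\<close> ensures this. Normalising \<open>x\<close> then
  extends the bound beyond the unit ball.\<close>

lemma lp_contraction_norm:
  assumes p: "p \<ge> 1" and T: "T \<in> lp_contractions p" and x: "x \<in> lp p"
  shows "lp_norm p (T x) \<le> lp_norm p x"
proof -
  obtain K where K: "\<forall>x\<in>lp p. lp_norm p (T x) \<le> K * lp_norm p x"
    using lp_contractionD(1)[OF T] by (auto simp: lp_operators_def)
  have "lp_norm p (T x) \<le> \<bar>K\<bar>" if "x \<in> lp p" "lp_norm p x \<le> 1" for x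
  proof -
    have "lp_norm p (T x) \<le> K * lp_norm p x" using K that by blast
    also have "\<dots> \<le> \<bar>K\<bar> * lp_norm p x" by (simp add: mult_right_mono)
    also have "\<dots> \<le> \<bar>K\<bar>" using that by (simp add: mult_left_le)
    finally show ?thesis .
  qed
  then have bdd: "bdd_above ((\<lambda>x. lp_norm p (T x)) ` {x \<in> lp p. lp_norm p x \<le> 1})"
    by (auto simp: bdd_above_def)
  have le1: "lp_norm p (T x) \<le> 1" if "x \<in> lp p" "lp_norm p x \<le> 1" for x
  proof -
    have "lp_norm p (T x) \<le> lp_opnorm p T"
      unfolding lp_opnorm_def using that by (intro cSUP_upper bdd) auto
    then show ?thesis using T by (simp add: lp_contractions_def)
  qed
  show ?thesis
  proof (cases "lp_norm p x = 0")
    case True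
    then show ?thesis using K x by fastforce
  next
    case False
    then have q: "lp_norm p x > 0" using lp_norm_nonneg[of p x] by linarith
    let ?c = "complex_of_real (1 / lp_norm p x)"
    have nc: "norm ?c = 1 / lp_norm p x" using q by (simp add: norm_divide)
    have "lp_norm p (T (\<lambda>n. ?c * x n)) \<le> 1"
      using p q by (intro le1 lp_scale[OF x]) (simp add: lp_norm_scale[OF _ x] nc del: of_real_divide)
    then have "1 / lp_norm p x * lp_norm p (T x) \<le> 1"
      using p by (simp add: lp_contractionD(4)[OF T x] lp_norm_scale[OF _ lp_contractionD(2)[OF T x]] nc
          del: of_real_divide)
    then show ?thesis using q by (simp add: field_simps)
  qed
qed

text \<open>Expanding the truncated vector in unit vectors shows that closeness on finitely many
  unit vectors gives closeness, uniformly on bounded sets, on all vectors supported below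
  \<open>m\<close>.\<close>

lemma lp_contraction_diff_cut:
  assumes p: "p \<ge> 1" and S: "S \<in> lp_contractions p" and T: "T \<in> lp_contractions p"
  shows "lp_norm p (\<lambda>n. S (lp_cut m x) n - T (lp_cut m x) n)
    \<le> (\<Sum>i<m. norm (x i) * lp_norm p (\<lambda>n. S (lp_unit i) n - T (lp_unit i) n))"
proof (induction m)
  case 0
  have z: "R (\<lambda>_. 0) = (\<lambda>_. 0)" if "R \<in> lp_contractions p" for R
    using lp_contractionD(4)[OF that zero_in_lp, of 0] by simp
  show ?case using p by (simp add: lp_cut_0 z[OF S] z[OF T] lp_norm_zero)
next
  case (Suc m)
  have e: "R (lp_cut (Suc m) x) = (\<lambda>n. R (lp_cut m x) n + x m * R (lp_unit m) n)"
    if "R \<in> lp_contractions p" for R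
    unfolding lp_cut_Suc
    by (simp add: lp_contractionD(3)[OF that lp_cut_in lp_scale[OF lp_unit_in]]
        lp_contractionD(4)[OF that lp_unit_in])
  have d: "(\<lambda>n. S y n - T y n) \<in> lp p" if "y \<in> lp p" for y
    by (intro lp_diff p lp_contractionD(2)[OF S] lp_contractionD(2)[OF T] that)
  have "(\<lambda>n. S (lp_cut (Suc m) x) n - T (lp_cut (Suc m) x) n)
      = (\<lambda>n. (S (lp_cut m x) n - T (lp_cut m x) n) + x m * (S (lp_unit m) n - T (lp_unit m) n))"
    by (simp add: e[OF S] e[OF T] algebra_simps)
  then have "lp_norm p (\<lambda>n. S (lp_cut (Suc m) x) n - T (lp_cut (Suc m) x) n)
      \<le> lp_norm p (\<lambda>n. S (lp_cut m x) n - T (lp_cut m x) n)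
        + lp_norm p (\<lambda>n. x m * (S (lp_unit m) n - T (lp_unit m) n))"
    using lp_add_triangle[OF p d[OF lp_cut_in] lp_scale[OF d[OF lp_unit_in]]] by simp
  then show ?case using Suc p by (simp add: lp_norm_scale[OF _ d[OF lp_unit_in]])
qed

section \<open>Functionals\<close>

lemma lp_dualD:
  assumes "\<phi> \<in> lp_dual p"
  shows "x \<in> lp p \<Longrightarrow> y \<in> lp p \<Longrightarrow> \<phi> (\<lambda>n. x n + y n) = \<phi> x + \<phi> y"
    and "x \<in> lp p \<Longrightarrow> \<phi> (\<lambda>n. c * x n) = c * \<phi> x"
  using assms by (auto simp: lp_dual_def)

lemma lp_dual_cut:
  assumes "\<phi> \<in> lp_dual p"
  shows "\<phi> (lp_cut m x) = (\<Sum>i<m. x i * \<phi> (lp_unit i))"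
proof (induction m)
  case 0
  show ?case using lp_dualD(2)[OF assms zero_in_lp, of 0] by (simp add: lp_cut_0)
next
  case (Suc m)
  have "\<phi> (lp_cut (Suc m) x) = \<phi> (lp_cut m x) + x m * \<phi> (lp_unit m)"
    unfolding lp_cut_Suc by (simp add: lp_dualD[OF assms] lp_cut_in lp_unit_in lp_scale)
  then show ?case using Suc by simp
qed

lemma lp_dual_split:
  assumes p: "p \<ge> 1" and f: "\<phi> \<in> lp_dual p" and x: "x \<in> lp p"
  shows "\<phi> x = \<phi> (lp_cut m x) + \<phi> (\<lambda>n. x n - lp_cut m x n)"
  using lp_dualD(1)[OF f lp_cut_in[of m x] lp_tail_in[OF p x, of m]] by simp

text \<open>Treats the \<open>j\<close>-th row of a contraction as a functional, so that
  \<open>lp_dual_tail\<close> applies to rows.\<close>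

lemma coord_in_lp_dual:
  assumes p: "p \<ge> 1" and T: "T \<in> lp_contractions p"
  shows "(\<lambda>x\<in>lp p. T x j) \<in> lp_dual p"
proof -
  have "norm (T x j) \<le> 1 * lp_norm p x" if "x \<in> lp p" for x
    using lp_norm_coord[OF _ lp_contractionD(2)[OF T that], of j] lp_contraction_norm[OF p T that] p
    by simp
  then show ?thesis
    unfolding lp_dual_def using p
    by (auto simp: lp_contractionD[OF T] lp_scale lp_add_triangle intro!: exI[of _ 1])
qed

text \<open>
  An almost norming vector \<open>x\<close> of finite support leaves no room for tail vectors \<open>y\<close>, since
  \<open>\<parallel>x + t y\<parallel>\<^sup>p \<le> 1 + t\<^sup>p\<close> while \<open>\<phi> (x + t y)\<close> can be made as large as \<open>\<parallel>\<phi>\<parallel> - \<delta> + t \<bar>\<phi> y\<bar>\<close>.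
\<close>

lemma lp_dual_tail:
  assumes p: "p > 1" and f: "\<phi> \<in> lp_dual p" and e: "\<epsilon> > 0"
  obtains m where "\<And>y. y \<in> lp p \<Longrightarrow> lp_norm p y \<le> 1 \<Longrightarrow> (\<And>i. i < m \<Longrightarrow> y i = 0) \<Longrightarrow> norm (\<phi> y) \<le> \<epsilon>"
proof -
  define N where "N = lp_dual_norm p \<phi>"
  have p0: "p > 0" and p1: "p \<ge> 1" using p by auto
  have N0: "N \<ge> 0" unfolding N_def by (rule lp_dual_norm_nonneg[OF p0 f])
  have bound: "norm (\<phi> x) \<le> N * lp_norm p x" if "x \<in> lp p" for x
    unfolding N_def by (rule lp_dual_norm_bound[OF p1 f that])
  \<comment> \<open>The final estimate is
    \<open>t * norm (\<phi> y) \<le> \<delta> + N * t powr p\<close>. After division by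
    \<open>t\<close> each summand may contribute \<open>\<epsilon> / 2\<close>; for the second one
    this is possible since \<open>p > 1\<close>.\<close>
  have "((\<lambda>t. N * t powr (p - 1)) \<longlongrightarrow> N * 0) (at_right 0)"
    using p by (intro tendsto_intros tendsto_zero_powrI) (auto simp: eventually_at_right_less eventually_at_filter)
  then have "eventually (\<lambda>t. N * t powr (p - 1) < \<epsilon> / 2) (at_right 0)"
    using e by (intro order_tendstoD) auto
  then have "eventually (\<lambda>t. N * t powr (p - 1) < \<epsilon> / 2 \<and> t > 0) (at_right 0)"
    by (intro eventually_conj) (auto simp: eventually_at_right_less)
  then obtain t where t: "N * t powr (p - 1) < \<epsilon> / 2" "t > 0"
    using eventually_happens'[OF trivial_limit_at_right_real] by blast
  define \<delta> where "\<delta> = t * \<epsilon> / 2"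
  have d: "\<delta> > 0" using t e by (simp add: \<delta>_def)
  have "\<exists>x\<in>{x \<in> lp p. lp_norm p x \<le> 1}. N - \<delta> / 2 < norm (\<phi> x)"
  proof -
    have "N - \<delta> / 2 < (SUP x\<in>{x \<in> lp p. lp_norm p x \<le> 1}. norm (\<phi> x))"
      using d by (simp add: N_def lp_dual_norm_def)
    moreover have "{x \<in> lp p. lp_norm p x \<le> 1} \<noteq> {}"
      using zero_in_lp[of p] lp_norm_zero[OF p0] by force
    ultimately show ?thesis using less_cSUP_iff[OF _ lp_dual_bdd_above[OF f]] by blast
  qed
  then obtain x where x: "x \<in> lp p" "lp_norm p x \<le> 1" "N - \<delta> / 2 < norm (\<phi> x)" by blast
  have "(\<lambda>m. N * lp_norm p (\<lambda>n. x n - lp_cut m x n)) \<longlonglongrightarrow> N * 0"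
    by (intro tendsto_intros lp_tail_tendsto p0 x)
  then have "eventually (\<lambda>m. N * lp_norm p (\<lambda>n. x n - lp_cut m x n) < \<delta> / 2) sequentially"
    using d by (intro order_tendstoD) auto
  then obtain m where m: "N * lp_norm p (\<lambda>n. x n - lp_cut m x n) < \<delta> / 2"
    by (auto simp: eventually_sequentially)
  define u where "u = lp_cut m x"
  have u: "u \<in> lp p" "lp_norm p u \<le> 1"
    using lp_norm_cut_le[OF p0 x(1), of m] x(2) by (auto simp: u_def lp_cut_in)
  have fu: "norm (\<phi> u) > N - \<delta>"
    using lp_dual_split[OF p1 f x(1), of m] bound[OF lp_tail_in[OF p1 x(1)], of m] m x(3)
      norm_triangle_ineq[of "\<phi> u" "\<phi> (\<lambda>n. x n - lp_cut m x n)"] by (simp add: u_def)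
  show ?thesis
  proof (rule that)
    fix y assume y: "y \<in> lp p" "lp_norm p y \<le> 1" "\<And>i. i < m \<Longrightarrow> y i = 0"
    \<comment> \<open>A unimodular factor that turns \<open>\<phi> y\<close> into the direction of
      \<open>\<phi> u\<close>, so that the two moduli add. If one of them is zero, any factor of
      modulus 1 works.\<close>
    define c where "c = (if \<phi> y = 0 \<or> \<phi> u = 0 then 1 else sgn (\<phi> u) / sgn (\<phi> y))"
    have nc: "norm c = 1" by (simp add: c_def norm_divide norm_sgn)
    have al: "norm (\<phi> u + of_real t * (c * \<phi> y)) = norm (\<phi> u) + t * norm (\<phi> y)"
    proof (cases "\<phi> y = 0 \<or> \<phi> u = 0")
      case True
      then show ?thesis using t(2) by (auto simp: c_def norm_mult)
    next
      case False
      then have "c * \<phi> y = sgn (\<phi> u) * of_real (norm (\<phi> y))"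
        by (simp add: c_def sgn_eq field_simps)
      moreover have "\<phi> u = sgn (\<phi> u) * of_real (norm (\<phi> u))" using False by (simp add: sgn_eq)
      ultimately have "\<phi> u + of_real t * (c * \<phi> y) = sgn (\<phi> u) * of_real (norm (\<phi> u) + t * norm (\<phi> y))"
        by (metis (no_types, opaque_lifting) mult.left_commute of_real_add of_real_mult distrib_left)
      also have "norm \<dots> = norm (\<phi> u) + t * norm (\<phi> y)"
        using False t(2) by (simp add: norm_mult norm_sgn del: of_real_add of_real_mult)
      finally show ?thesis .
    qed
    let ?v = "\<lambda>n. of_real t * c * y n"
    have v: "?v \<in> lp p" "lp_norm p ?v \<le> t"
      using lp_scale[OF y(1)] lp_norm_scale[OF p0 y(1), of "of_real t * c"] y(2) t(2)
      by (auto simp: norm_mult nc mult_left_le)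
    have dj: "u n = 0 \<or> ?v n = 0" for n using y(3) by (auto simp: u_def lp_cut_def)
    have uv: "(\<lambda>n. u n + ?v n) \<in> lp p" by (rule lp_norm_disjoint(1)[OF p0 u(1) v(1) dj])
    have "lp_norm p (\<lambda>n. u n + ?v n) powr p = lp_norm p u powr p + lp_norm p ?v powr p"
      by (rule lp_norm_disjoint(2)[OF p0 u(1) v(1) dj])
    also have "\<dots> \<le> 1 powr p + t powr p" using u v p0 by (intro add_mono powr_mono2) auto
    \<comment> \<open>As \<open>1 + t powr p\<close> is at least 1, it bounds its own
      \<open>p\<close>-th root; this crude bound still has error of order
      \<open>t powr p\<close>.\<close>
    also have "\<dots> \<le> (1 + t powr p) powr p"
      using powr_mono[of 1 p "1 + t powr p"] p1 by simp
    finally have le: "lp_norm p (\<lambda>n. u n + ?v n) \<le> 1 + t powr p"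
      by (subst lp_norm_le_iff_powr) (use p0 in auto)
    have "\<phi> (\<lambda>n. u n + ?v n) = \<phi> u + of_real t * (c * \<phi> y)"
      using lp_dualD(1)[OF f u(1) v(1)] lp_dualD(2)[OF f y(1), of "of_real t * c"]
      by (simp add: mult.assoc)
    then have "norm (\<phi> u) + t * norm (\<phi> y) \<le> N * lp_norm p (\<lambda>n. u n + ?v n)"
      using bound[OF uv] al by simp
    also have "\<dots> \<le> N * (1 + t powr p)" by (rule mult_left_mono[OF le N0])
    finally have "t * norm (\<phi> y) \<le> \<delta> + N * t powr p" using fu by (simp add: distrib_left)
    also have "t powr p = t * t powr (p - 1)" using t(2) by (simp add: powr_diff)
    also have "\<delta> + N * (t * t powr (p - 1)) \<le> t * \<epsilon>"
      using mult_strict_left_mono[OF t] by (simp add: \<delta>_def algebra_simps)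
    finally show "norm (\<phi> y) \<le> \<epsilon>" using t(2) by simp
  qed
qed

section \<open>Convergence of contractions in SOT*\<close>

lemma lp_diff_triangle:
  assumes "p \<ge> 1" "x \<in> lp p" "y \<in> lp p"
  shows "lp_norm p (\<lambda>n. x n - y n) \<le> lp_norm p x + lp_norm p y"
proof -
  have "lp_norm p (\<lambda>n. -1 * y n) = lp_norm p y"
    using assms by (subst lp_norm_scale) auto
  then show ?thesis
    using lp_add_triangle[OF assms(1,2) lp_scale[OF assms(3), of "-1"]] by simp
qed

lemma lp_contraction_diff_norm:
  assumes p: "p \<ge> 1" and S: "S \<in> lp_contractions p" and T: "T \<in> lp_contractions p" and x: "x \<in> lp p"
  shows "(\<lambda>n. S x n - T x n) \<in> lp p" and "lp_norm p (\<lambda>n. S x n - T x n) \<le> 2 * lp_norm p x"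
  using lp_diff[OF p lp_contractionD(2)[OF S x] lp_contractionD(2)[OF T x]]
    lp_diff_triangle[OF p lp_contractionD(2)[OF S x] lp_contractionD(2)[OF T x]]
    lp_contraction_norm[OF p S x] lp_contraction_norm[OF p T x] by auto

lemma lp_contraction_cut_tail:
  assumes p: "p \<ge> 1" and T: "T \<in> lp_contractions p" and x: "x \<in> lp p"
  shows "T x n = T (lp_cut m x) n + T (\<lambda>n. x n - lp_cut m x n) n"
  using lp_contractionD(3)[OF T lp_cut_in[of m x] lp_tail_in[OF p x, of m]] by simp

lemma lp_contraction_diff_split:
  assumes p: "p \<ge> 1" and S: "S \<in> lp_contractions p" and T: "T \<in> lp_contractions p" and x: "x \<in> lp p"
  shows "lp_norm p (\<lambda>n. S x n - T x n)
    \<le> (\<Sum>i<m. norm (x i) * lp_norm p (\<lambda>n. S (lp_unit i) n - T (lp_unit i) n))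
      + 2 * lp_norm p (\<lambda>n. x n - lp_cut m x n)"
proof -
  let ?u = "lp_cut m x" and ?v = "\<lambda>n. x n - lp_cut m x n"
  note d = lp_contraction_diff_norm[OF p S T]
  have "(\<lambda>n. S x n - T x n) = (\<lambda>n. (S ?u n - T ?u n) + (S ?v n - T ?v n))"
  proof
    show "S x n - T x n = (S ?u n - T ?u n) + (S ?v n - T ?v n)" for n
      using lp_contraction_cut_tail[OF p S x, of n m] lp_contraction_cut_tail[OF p T x, of n m] by simp
  qed
  then have "lp_norm p (\<lambda>n. S x n - T x n)
      \<le> lp_norm p (\<lambda>n. S ?u n - T ?u n) + lp_norm p (\<lambda>n. S ?v n - T ?v n)"
    using lp_add_triangle[OF p d(1)[OF lp_cut_in] d(1)[OF lp_tail_in[OF p x]]] by simp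
  then show ?thesis
    using lp_contraction_diff_cut[OF p S T, of m x] d(2)[OF lp_tail_in[OF p x], of m] by linarith
qed

text \<open>Since contractions are uniformly bounded, convergence need only be checked on dense
  sets: on vectors of finite support, given by the columns, and for the adjoints on combinations of
  coordinate functionals, given by the rows. Density of the latter in the dual is
  \<open>lp_dual_tail\<close>, where \<open>p > 1\<close> enters.\<close>

lemma limitin_SOT_star_contractions:
  assumes p: "p > 1" and T: "T \<in> lp_contractions p" and S: "\<And>n. S n \<in> lp_contractions p"
    and columns: "\<And>i. ((\<lambda>n. lp_norm p (\<lambda>k. S n (lp_unit i) k - T (lp_unit i) k)) \<longlongrightarrow> 0) F"
    and rows: "\<And>j \<epsilon>. \<epsilon> > 0 \<Longrightarrow>
      \<forall>\<^sub>F n in F. \<forall>y\<in>lp p. lp_norm p y \<le> 1 \<longrightarrow> norm (S n y j - T y j) \<le> \<epsilon>"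
  shows "limitin (lp_SOT_star p) S T F"
proof -
  have p1: "p \<ge> 1" and p0: "p > 0" using p by auto
  note op = lp_contractionD(1)
  have pt: "((\<lambda>n. lp_norm p (\<lambda>k. S n x k - T x k)) \<longlongrightarrow> 0) F" if x: "x \<in> lp p" for x
  proof (rule tendstoI)
    fix \<epsilon> :: real assume e: "\<epsilon> > 0"
    have "eventually (\<lambda>m. lp_norm p (\<lambda>n. x n - lp_cut m x n) < \<epsilon> / 4) sequentially"
      using order_tendstoD(2)[OF lp_tail_tendsto[OF p0 x], of "\<epsilon> / 4"] e by simp
    then obtain m where m: "lp_norm p (\<lambda>n. x n - lp_cut m x n) < \<epsilon> / 4"
      by (auto simp: eventually_sequentially)
    let ?s = "\<lambda>n. \<Sum>i<m. norm (x i) * lp_norm p (\<lambda>k. S n (lp_unit i) k - T (lp_unit i) k)"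
    have "(?s \<longlongrightarrow> (\<Sum>i<m. norm (x i) * 0)) F" by (intro tendsto_intros columns)
    then have "eventually (\<lambda>n. ?s n < \<epsilon> / 2) F" using e by (intro order_tendstoD) auto
    then show "eventually (\<lambda>n. dist (lp_norm p (\<lambda>k. S n x k - T x k)) 0 < \<epsilon>) F"
    proof (rule eventually_mono)
      fix n assume "?s n < \<epsilon> / 2"
      then show "dist (lp_norm p (\<lambda>k. S n x k - T x k)) 0 < \<epsilon>"
        using lp_contraction_diff_split[OF p1 S T x, of n m] m by simp
    qed
  qed
  have dl: "((\<lambda>n. lp_dual_norm p (\<lambda>x. lp_adjoint p (S n) \<phi> x - lp_adjoint p T \<phi> x)) \<longlongrightarrow> 0) F"
    if f: "\<phi> \<in> lp_dual p" for \<phi>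
  proof (rule tendstoI)
    fix \<epsilon> :: real assume e: "\<epsilon> > 0"
    \<comment> \<open>The tail is later applied to a difference \<open>z\<close> of norm at most 2.
      Halving it brings it into the unit ball, so \<open>\<epsilon> / 8\<close> here becomes
      \<open>\<epsilon> / 4\<close> there.\<close>
    obtain m where m: "\<And>y. y \<in> lp p \<Longrightarrow> lp_norm p y \<le> 1 \<Longrightarrow> (\<And>i. i < m \<Longrightarrow> y i = 0)
        \<Longrightarrow> norm (\<phi> y) \<le> \<epsilon> / 8"
      using lp_dual_tail[OF p f, of "\<epsilon> / 8"] e by auto
    define W where "W = (\<Sum>j<m. norm (\<phi> (lp_unit j)))"
    have W: "W \<ge> 0" by (simp add: W_def sum_nonneg)
    \<comment> \<open>Makes \<open>\<eta> * W\<close> at most \<open>\<epsilon> / 4\<close>; the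
      summand 1 keeps the denominator positive when \<open>W = 0\<close>.\<close>
    define \<eta> where "\<eta> = \<epsilon> / (4 * (1 + W))"
    have eta: "\<eta> > 0" using e W by (simp add: \<eta>_def)
    have "\<eta> * W \<le> \<epsilon> / 4" using e W by (simp add: \<eta>_def field_simps)
    have "eventually (\<lambda>n. \<forall>j\<in>{..<m}. \<forall>y\<in>lp p. lp_norm p y \<le> 1 \<longrightarrow> norm (S n y j - T y j) \<le> \<eta>) F"
      using rows[OF eta] by (intro eventually_ball_finite) auto
    then show "eventually (\<lambda>n. dist (lp_dual_norm p (\<lambda>x. lp_adjoint p (S n) \<phi> x - lp_adjoint p T \<phi> x)) 0 < \<epsilon>) F"
    proof (rule eventually_mono)
      fix n assume row: "\<forall>j\<in>{..<m}. \<forall>y\<in>lp p. lp_norm p y \<le> 1 \<longrightarrow> norm (S n y j - T y j) \<le> \<eta>"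
      let ?g = "\<lambda>x. lp_adjoint p (S n) \<phi> x - lp_adjoint p T \<phi> x"
      have "norm (?g y) \<le> \<epsilon> / 2" if y: "y \<in> lp p" "lp_norm p y \<le> 1" for y
      proof -
        define z where "z = (\<lambda>k. S n y k - T y k)"
        have z: "z \<in> lp p" "lp_norm p z \<le> 2"
          using lp_contraction_diff_norm[OF p1 S T y(1), of n] y(2) by (auto simp: z_def)
        have "S n y = (\<lambda>k. T y k + z k)" by (simp add: z_def)
        then have "?g y = \<phi> z"
          using f y(1) lp_dualD(1)[OF f lp_contractionD(2)[OF T y(1)] z(1)] by (simp add: lp_adjoint_def)
        also have "\<phi> z = \<phi> (lp_cut m z) + \<phi> (\<lambda>k. z k - lp_cut m z k)"
          by (rule lp_dual_split[OF p1 f z(1)])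
        finally have "norm (?g y) \<le> norm (\<phi> (lp_cut m z)) + norm (\<phi> (\<lambda>k. z k - lp_cut m z k))"
          by (simp add: norm_triangle_ineq)
        moreover have "norm (\<phi> (lp_cut m z)) \<le> \<epsilon> / 4"
        proof -
          have "norm (\<phi> (lp_cut m z)) \<le> (\<Sum>j<m. norm (z j) * norm (\<phi> (lp_unit j)))"
            unfolding lp_dual_cut[OF f] by (rule order_trans[OF norm_sum]) (simp add: norm_mult)
          also have "\<dots> \<le> (\<Sum>j<m. \<eta> * norm (\<phi> (lp_unit j)))"
            using row y by (intro sum_mono mult_right_mono) (auto simp: z_def)
          also have "\<dots> = \<eta> * W" by (simp add: W_def sum_distrib_left)
          finally show ?thesis using \<open>\<eta> * W \<le> \<epsilon> / 4\<close> by linarith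
        qed
        moreover have "norm (\<phi> (\<lambda>k. z k - lp_cut m z k)) \<le> \<epsilon> / 4"
        proof -
          note t = lp_tail_in[OF p1 z(1), of m]
          have "norm (\<phi> (\<lambda>k. (1/2) * (z k - lp_cut m z k))) \<le> \<epsilon> / 8"
          proof (rule m[OF lp_scale[OF t]])
            show "lp_norm p (\<lambda>k. 1 / 2 * (z k - lp_cut m z k)) \<le> 1"
              using lp_norm_tail_le[OF p0 z(1), of m] z(2) by (subst lp_norm_scale[OF p0 t]) simp
          qed (simp add: lp_cut_def)
          then show ?thesis by (subst (asm) lp_dualD(2)[OF f t]) (simp add: norm_mult)
        qed
        ultimately show ?thesis by simp
      qed
      then have "lp_dual_norm p ?g \<le> \<epsilon> / 2"
        unfolding lp_dual_norm_def
        using zero_in_lp[of p] lp_norm_zero[OF p0] by (intro cSUP_least) (auto intro!: exI[of _ "\<lambda>_. 0"])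
      moreover have "0 \<le> lp_dual_norm p ?g"
        using lp_dual_norm_nonneg[OF p0 lp_dual_diff[OF p1 lp_adjoint_in_dual[OF p1 op[OF S] f]
              lp_adjoint_in_dual[OF p1 op[OF T] f]], of n]
        by (simp add: lp_dual_norm_restrict)
      ultimately show "dist (lp_dual_norm p ?g) 0 < \<epsilon>" using e by simp
    qed
  qed
  show ?thesis
    unfolding limitin_lp_SOT_star[OF p1] using pt dl op[OF T] op[OF S] by auto
qed

section \<open>Rigidity near almost norming vectors\<close>

lemma powr_half_square: "x \<ge> 0 \<Longrightarrow> (x\<^sup>2) powr (p / 2) = x powr (p::real)"
  by (cases "x = 0") (simp_all add: powr_powr flip: powr_numeral)

text \<open>By the parallelogram law the mean of the squares of \<open>norm (a + b)\<close> and
  \<open>norm (a - b)\<close> is \<open>u + v\<close>, with \<open>u\<close> and \<open>v\<close>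
  the squares of \<open>norm a\<close> and \<open>norm b\<close>. Convexity of the power
  \<open>p / 2\<close> passes to \<open>p\<close>-th powers, and \<open>(u + v) powr (p / 2)\<close>
  is at least \<open>(u + v) * u powr ((p - 2) / 2)\<close>.\<close>

lemma norm_powr_parallelogram:
  fixes a b :: complex
  assumes p: "p \<ge> 2"
  shows "norm a powr p + norm a powr (p - 2) * (norm b)\<^sup>2 \<le> (norm (a + b) powr p + norm (a - b) powr p) / 2"
proof -
  let ?u = "(norm a)\<^sup>2" and ?v = "(norm b)\<^sup>2"
  have uv: "1/2 * (norm (a + b))\<^sup>2 + 1/2 * (norm (a - b))\<^sup>2 = ?u + ?v"
    unfolding cmod_power2 by (simp add: power2_eq_square field_simps)
  have e: "p / 2 = (p - 2) / 2 + 1" by (simp add: field_simps)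
  have pw: "w powr (p / 2) = w * w powr ((p - 2) / 2)" if "w \<ge> 0" for w :: real
    unfolding e powr_add using that by simp
  have "norm a powr p + norm a powr (p - 2) * ?v = (?u + ?v) * ?u powr ((p - 2) / 2)"
    using pw[of ?u] by (simp add: powr_half_square algebra_simps)
  also have "\<dots> \<le> (?u + ?v) * (?u + ?v) powr ((p - 2) / 2)"
    using p by (intro mult_left_mono powr_mono2) auto
  also have "\<dots> = (?u + ?v) powr (p / 2)" by (simp add: pw)
  also have "\<dots> \<le> 1/2 * ((norm (a + b))\<^sup>2) powr (p / 2) + 1/2 * ((norm (a - b))\<^sup>2) powr (p / 2)"
    unfolding uv[symmetric] using p by (intro powr_convex_combination) auto
  also have "\<dots> = (norm (a + b) powr p + norm (a - b) powr p) / 2"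
    by (simp add: powr_half_square field_simps)
  finally show ?thesis .
qed

text \<open>The scalar inequality is summed over all coordinates; the quadratic surplus is kept at
  \<open>j\<close> and dropped elsewhere.\<close>

lemma lp_norm_parallelogram:
  assumes p: "p \<ge> 2" and a: "a \<in> lp p" and b: "b \<in> lp p"
  shows "lp_norm p a powr p + norm (a j) powr (p - 2) * (norm (b j))\<^sup>2
    \<le> (lp_norm p (\<lambda>n. a n + b n) powr p + lp_norm p (\<lambda>n. a n - b n) powr p) / 2"
proof -
  have p0: "p > 0" and p1: "p \<ge> 1" using p by auto
  let ?h = "\<lambda>n. if n = j then norm (a j) powr (p - 2) * (norm (b j))\<^sup>2 else 0"
  have h: "?h sums (norm (a j) powr (p - 2) * (norm (b j))\<^sup>2)" by (rule sums_single)
  have S: "(\<lambda>n. norm (x n) powr p) sums (lp_norm p x powr p)" if "x \<in> lp p" for x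
    using that by (simp add: lp_norm_powr[OF p0] lp_def summable_sums)
  have ab: "(\<lambda>n. a n + b n) \<in> lp p" "(\<lambda>n. a n - b n) \<in> lp p"
    using lp_add_triangle[OF p1 a b] lp_diff[OF p1 a b] by auto
  show ?thesis
  proof (rule sums_le[OF _ sums_add[OF S[OF a] h] sums_divide[OF sums_add[OF S[OF ab(1)] S[OF ab(2)]]]])
    fix n
    have "?h n \<le> norm (a n) powr (p - 2) * (norm (b n))\<^sup>2" by simp
    then show "norm (a n) powr p + ?h n \<le> (norm (a n + b n) powr p + norm (a n - b n) powr p) / 2"
      using norm_powr_parallelogram[OF p, of "a n" "b n"] by linarith
  qed
qed

text \<open>By disjointness of supports and contractivity, both \<open>S x + t S y\<close> and
  \<open>S x - t S y\<close> have \<open>p\<close>-th power norm at most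
  \<open>1 + t powr p\<close>. Averaging the two signs cancels the linear terms and leaves the
  quadratic one at \<open>j\<close>.\<close>

lemma lp_contraction_tail_coord:
  assumes p: "p \<ge> 2" and S: "S \<in> lp_contractions p"
    and x: "x \<in> lp p" "lp_norm p x \<le> 1" "\<And>i. i \<ge> m \<Longrightarrow> x i = 0"
    and y: "y \<in> lp p" "lp_norm p y \<le> 1" "\<And>i. i < m \<Longrightarrow> y i = 0" and t: "t > 0"
  shows "norm (S x j) powr (p - 2) * (t\<^sup>2 * (norm (S y j))\<^sup>2) \<le> 1 + t powr p - lp_norm p (S x) powr p"
proof -
  have p0: "p > 0" and p1: "p \<ge> 1" using p by auto
  have b: "lp_norm p (\<lambda>n. S x n + s * S y n) powr p \<le> 1 + t powr p" if s: "norm s = t" for s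
  proof -
    note sy = lp_scale[OF y(1), of s]
    have dj: "x n = 0 \<or> s * y n = 0" for n using x(3) y(3) by (cases "n < m") auto
    note D = lp_norm_disjoint[OF p0 x(1) sy dj]
    have "S (\<lambda>n. x n + s * y n) = (\<lambda>n. S x n + s * S y n)"
      by (simp add: lp_contractionD(3)[OF S x(1) sy] lp_contractionD(4)[OF S y(1)])
    then have "lp_norm p (\<lambda>n. S x n + s * S y n) powr p \<le> lp_norm p (\<lambda>n. x n + s * y n) powr p"
      using lp_contraction_norm[OF p1 S D(1)] p0 by (intro powr_mono2) auto
    also have "\<dots> = lp_norm p x powr p + (t * lp_norm p y) powr p"
      by (simp add: D(2) lp_norm_scale[OF p0 y(1)] s)
    also have "\<dots> \<le> 1 powr p + (t * 1) powr p"
      using x y t p0 by (intro add_mono powr_mono2 mult_left_mono) auto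
    finally show ?thesis by simp
  qed
  have "lp_norm p (S x) powr p + norm (S x j) powr (p - 2) * (norm (of_real t * S y j))\<^sup>2
     \<le> (lp_norm p (\<lambda>n. S x n + of_real t * S y n) powr p + lp_norm p (\<lambda>n. S x n - of_real t * S y n) powr p) / 2"
    by (rule lp_norm_parallelogram[OF p lp_contractionD(2)[OF S x(1)]
          lp_scale[OF lp_contractionD(2)[OF S y(1)]]])
  also have "\<dots> \<le> 1 + t powr p"
    using b[of "of_real t"] b[of "- of_real t"] t by simp
  finally show ?thesis using t by (simp add: norm_mult power_mult_distrib)
qed

text \<open>\<open>X\<close> consists of one almost norming vector supported below \<open>m\<close>
  and the unit vectors below \<open>m\<close>. On the head of \<open>y\<close> the unit vectors
  force \<open>S\<close> near \<open>B\<close>; on its tail \<open>B\<close> vanishes and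
  \<open>lp_contraction_tail_coord\<close> makes \<open>S\<close> small, because
  \<open>t powr p\<close> is negligible against the square of \<open>t\<close> when
  \<open>p > 2\<close>.\<close>

lemma lp_contraction_rigid:
  assumes p: "p > 2" and B: "B \<in> lp_contractions p"
    and cutB: "\<And>x. x \<in> lp p \<Longrightarrow> B (lp_cut m x) = B x"
    and c: "c > 0" and e: "\<epsilon> > 0"
    and good: "\<And>x j. x \<in> lp p \<Longrightarrow> lp_norm p x \<le> 1 \<Longrightarrow> 1 - c \<le> lp_norm p (B x) \<Longrightarrow> j < k \<Longrightarrow>
      c \<le> norm (B x j)"
    and near: "\<And>\<gamma>. \<gamma> > 0 \<Longrightarrow> \<exists>x\<in>lp p. lp_norm p x \<le> 1 \<and> 1 - \<gamma> \<le> lp_norm p (B x)"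
  obtains X \<delta> where "finite X" "X \<subseteq> lp p" "\<delta> > 0"
    "\<And>S j y. S \<in> lp_contractions p \<Longrightarrow> (\<And>x. x \<in> X \<Longrightarrow> lp_norm p (\<lambda>n. S x n - B x n) < \<delta>) \<Longrightarrow>
      j < k \<Longrightarrow> y \<in> lp p \<Longrightarrow> lp_norm p y \<le> 1 \<Longrightarrow> norm (S y j - B y j) \<le> \<epsilon>"
proof -
  have p0: "p > 0" and p1: "p \<ge> 1" and p2: "p \<ge> 2" using p by auto
  \<comment> \<open>Lower bound for \<open>norm (S x j) powr (p - 2)\<close>:
    \<open>norm (B x j)\<close> is at least \<open>c\<close>, and passing from \<open>B\<close> to
    \<open>S\<close> costs less than \<open>c / 2\<close>.\<close>
  define d where "d = (c / 2) powr (p - 2)"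
  have d: "d > 0" using c by (simp add: d_def)
  have "((\<lambda>t. t powr (p - 2)) \<longlongrightarrow> 0) (at_right 0)"
    using p by (intro tendsto_zero_powrI) (auto simp: eventually_at_right_less eventually_at_filter)
  then have "eventually (\<lambda>t. t powr (p - 2) < d * \<epsilon>\<^sup>2 / 8) (at_right 0)"
    using e d by (intro order_tendstoD) auto
  then have "eventually (\<lambda>t. t powr (p - 2) < d * \<epsilon>\<^sup>2 / 8 \<and> t > 0) (at_right 0)"
    by (intro eventually_conj) (auto simp: eventually_at_right_less)
  then obtain t where t: "t powr (p - 2) < d * \<epsilon>\<^sup>2 / 8" "t > 0"
    using eventually_happens'[OF trivial_limit_at_right_real] by blast
  \<comment> \<open>Chosen so that \<open>2 * h\<close> is \<open>d\<close> times the square of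
    \<open>t * (\<epsilon> / 2)\<close>. One \<open>h\<close> pays for \<open>t powr p\<close>, the
    other for the defect of \<open>x\<close> from being norming.\<close>
  define h where "h = d * t\<^sup>2 * \<epsilon>\<^sup>2 / 8"
  have h: "h > 0" using d t e by (simp add: h_def)
  have "t powr p = t powr (p - 2) * t\<^sup>2" using t(2) by (simp add: powr_diff)
  also have "\<dots> < d * \<epsilon>\<^sup>2 / 8 * t\<^sup>2" by (rule mult_strict_right_mono[OF t(1)]) (use t(2) in simp)
  finally have tp: "t powr p \<le> h" by (simp add: h_def mult_ac)
  \<comment> \<open>\<open>S x\<close> has norm at least \<open>1 - 2 * \<gamma>\<close>: one
    \<open>\<gamma>\<close> is lost because \<open>x\<close> is only almost norming, one in passing
    from \<open>B\<close> to \<open>S\<close>. The bound \<open>1 / 4\<close> keeps the base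
    positive.\<close>
  have "((\<lambda>\<gamma>::real. (1 - 2 * \<gamma>) powr p) \<longlongrightarrow> (1 - 2 * 0) powr p) (at_right 0)"
    by (intro tendsto_intros) auto
  then have "eventually (\<lambda>\<gamma>. 1 - h < (1 - 2 * \<gamma>) powr p) (at_right 0)"
    using h by (intro order_tendstoD) auto
  moreover have "eventually (\<lambda>\<gamma>. \<gamma> \<in> {0<..<min (c / 2) (1 / 4)}) (at_right 0)"
    using c by (intro eventually_at_right_real) simp
  ultimately have "eventually (\<lambda>\<gamma>. 1 - h < (1 - 2 * \<gamma>) powr p \<and> \<gamma> \<in> {0<..<min (c / 2) (1 / 4)}) (at_right 0)"
    by (rule eventually_conj)
  then obtain \<gamma> where g: "1 - h < (1 - 2 * \<gamma>) powr p" "\<gamma> > 0" "\<gamma> < c / 2" "\<gamma> < 1 / 4"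
    using eventually_happens'[OF trivial_limit_at_right_real] by fastforce
  obtain x0 where x0: "x0 \<in> lp p" "lp_norm p x0 \<le> 1" "1 - \<gamma> \<le> lp_norm p (B x0)"
    using near[OF g(2)] by blast
  \<comment> \<open>Truncation does not change the image under \<open>B\<close>, and it makes
    \<open>x\<close> disjoint from the tails to be tested.\<close>
  define x where "x = lp_cut m x0"
  have x: "x \<in> lp p" "lp_norm p x \<le> 1" "1 - \<gamma> \<le> lp_norm p (B x)" "\<And>i. i \<ge> m \<Longrightarrow> x i = 0"
    using lp_norm_cut_le[OF p0 x0(1), of m] x0 cutB[OF x0(1)] by (auto simp: x_def lp_cut_in) (simp add: lp_cut_def)
  \<comment> \<open>The second entry bounds the sum of \<open>m\<close> unit vector errors by
    \<open>\<epsilon> / 2\<close>; adding 1 to \<open>m\<close> covers the case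
    \<open>m = 0\<close>.\<close>
  define \<delta> where "\<delta> = min \<gamma> (\<epsilon> / (2 * (real m + 1)))"
  have dl: "\<delta> > 0" "\<delta> \<le> \<gamma>" using g e by (auto simp: \<delta>_def)
  have "\<delta> \<le> \<epsilon> / (2 * (real m + 1))" by (simp add: \<delta>_def)
  then have "\<delta> * (2 * (real m + 1)) \<le> \<epsilon>" by (simp add: pos_le_divide_eq)
  then have md: "m * \<delta> \<le> \<epsilon> / 2" using dl by (simp add: algebra_simps)
  show ?thesis
  proof (rule that)
    show "finite (insert x (lp_unit ` {..<m}))" by simp
    show "insert x (lp_unit ` {..<m}) \<subseteq> lp p" using x(1) lp_unit_in by auto
    show "\<delta> > 0" by (rule dl)
    fix S j y
    assume S: "S \<in> lp_contractions p"
      and XX: "\<And>x'. x' \<in> insert x (lp_unit ` {..<m}) \<Longrightarrow> lp_norm p (\<lambda>n. S x' n - B x' n) < \<delta>"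
      and j: "j < k" and y: "y \<in> lp p" "lp_norm p y \<le> 1"
    have sx: "lp_norm p (\<lambda>n. S x n - B x n) < \<delta>" using XX by simp
    note SB = lp_contraction_diff_norm(1)[OF p1 S B]
    have "lp_norm p (B x) \<le> lp_norm p (S x) + lp_norm p (\<lambda>n. S x n - B x n)"
      using lp_diff_triangle[OF p1 lp_contractionD(2)[OF S x(1)] SB[OF x(1)]] by simp
    then have n1: "1 - 2 * \<gamma> \<le> lp_norm p (S x)" using sx x(3) dl by linarith
    have "c \<le> norm (B x j)" using good[OF x(1,2) _ j] x(3) g c by simp
    moreover have "norm (S x j - B x j) \<le> \<delta>" using lp_norm_coord[OF p0 SB[OF x(1)], of j] sx by simp
    ultimately have n2: "c / 2 \<le> norm (S x j)"
      using norm_triangle_ineq2[of "B x j" "S x j"] norm_minus_commute[of "B x j" "S x j"] dl g by linarith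
    define v where "v = (\<lambda>n. y n - lp_cut m y n)"
    have v: "v \<in> lp p" "lp_norm p v \<le> 1" "\<And>i. i < m \<Longrightarrow> v i = 0"
      using lp_tail_in[OF p1 y(1), of m] lp_norm_tail_le[OF p0 y(1), of m] y(2)
      by (auto simp: v_def) (simp add: lp_cut_def)
    have "d * (t\<^sup>2 * (norm (S v j))\<^sup>2) \<le> norm (S x j) powr (p - 2) * (t\<^sup>2 * (norm (S v j))\<^sup>2)"
      unfolding d_def using n2 c p by (intro mult_right_mono powr_mono2) auto
    also have "\<dots> \<le> 1 + t powr p - lp_norm p (S x) powr p"
      by (rule lp_contraction_tail_coord[OF p2 S x(1,2,4) v t(2)])
    also have "\<dots> \<le> 1 + h - (1 - 2 * \<gamma>) powr p"
      using tp n1 g p0 by (intro diff_mono add_left_mono powr_mono2) auto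
    also have "\<dots> \<le> 2 * h" using g by simp
    also have "2 * h = d * (t\<^sup>2 * (\<epsilon> / 2)\<^sup>2)" by (simp add: h_def power_divide)
    finally have "(norm (S v j))\<^sup>2 \<le> (\<epsilon> / 2)\<^sup>2" using d t(2) by simp
    then have sv: "norm (S v j) \<le> \<epsilon> / 2" by (rule power2_le_imp_le) (use e in simp)
    have "norm (S (lp_cut m y) j - B (lp_cut m y) j) \<le> lp_norm p (\<lambda>n. S (lp_cut m y) n - B (lp_cut m y) n)"
      using lp_norm_coord[OF p0 SB[OF lp_cut_in], of m y j] by simp
    also have "\<dots> \<le> (\<Sum>i<m. norm (y i) * lp_norm p (\<lambda>n. S (lp_unit i) n - B (lp_unit i) n))"
      by (rule lp_contraction_diff_cut[OF p1 S B])
    also have "\<dots> \<le> (\<Sum>i<m. 1 * \<delta>)"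
    proof (intro sum_mono mult_mono)
      fix i assume "i \<in> {..<m}"
      show "norm (y i) \<le> 1" by (rule order_trans[OF lp_norm_coord[OF p0 y(1)] y(2)])
      show "lp_norm p (\<lambda>n. S (lp_unit i) n - B (lp_unit i) n) \<le> \<delta>"
        using XX[of "lp_unit i"] \<open>i \<in> {..<m}\<close> by simp
    qed simp_all
    finally have "norm (S (lp_cut m y) j - B (lp_cut m y) j) \<le> \<epsilon> / 2" using md by simp
    moreover have "S y j - B y j = (S (lp_cut m y) j - B (lp_cut m y) j) + S v j"
      using lp_contraction_cut_tail[OF p1 S y(1), of j m] cutB[OF y(1)] by (simp add: v_def)
    ultimately show "norm (S y j - B y j) \<le> \<epsilon>"
      using sv norm_triangle_ineq[of "S (lp_cut m y) j - B (lp_cut m y) j" "S v j"] by simp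
  qed
qed

section \<open>Perturbation to an operator with rigid rows\<close>

text \<open>Restriction to \<open>I - {i}\<close> is injective on the functions that are bad at
  \<open>i\<close>, so there are at most \<open>card G ^ (card I - 1)\<close> of them. With
  \<open>card I < card G\<close>, these \<open>card I\<close> sets cannot cover the function
  space.\<close>

lemma exists_PiE_avoiding:
  assumes I: "finite I" and G: "finite G" "card I < card G"
    and bad: "\<And>i v v'. i \<in> I \<Longrightarrow> v \<in> I \<rightarrow>\<^sub>E G \<Longrightarrow> v' \<in> I \<rightarrow>\<^sub>E G \<Longrightarrow> Bad i v \<Longrightarrow> Bad i v' \<Longrightarrow>
      (\<And>k. k \<in> I \<Longrightarrow> k \<noteq> i \<Longrightarrow> v k = v' k) \<Longrightarrow> v i = v' i"
  shows "\<exists>v\<in>I \<rightarrow>\<^sub>E G. \<forall>i\<in>I. \<not> Bad i v"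
proof (rule ccontr)
  assume "\<not> ?thesis"
  then have cover: "I \<rightarrow>\<^sub>E G \<subseteq> (\<Union>i\<in>I. {v \<in> I \<rightarrow>\<^sub>E G. Bad i v})" by blast
  have fin: "finite (I \<rightarrow>\<^sub>E G)" using I G by (intro finite_PiE) auto
  have le: "card {v \<in> I \<rightarrow>\<^sub>E G. Bad i v} \<le> card G ^ (card I - 1)" if i: "i \<in> I" for i
  proof -
    have inj: "inj_on (\<lambda>v. restrict v (I - {i})) {v \<in> I \<rightarrow>\<^sub>E G. Bad i v}"
    proof (rule inj_onI)
      fix v v' assume v: "v \<in> {v \<in> I \<rightarrow>\<^sub>E G. Bad i v}" "v' \<in> {v \<in> I \<rightarrow>\<^sub>E G. Bad i v}"
        and e: "restrict v (I - {i}) = restrict v' (I - {i})"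
      have e': "v k = v' k" if "k \<in> I" "k \<noteq> i" for k
        using fun_cong[OF e, of k] that by simp
      have "v i = v' i" by (rule bad[OF i]) (use v e' in auto)
      then show "v = v'" using v e' by (intro PiE_ext[of v I "\<lambda>_. G"]) auto
    qed
    have "(\<lambda>v. restrict v (I - {i})) ` {v \<in> I \<rightarrow>\<^sub>E G. Bad i v} \<subseteq> (I - {i}) \<rightarrow>\<^sub>E G"
      by (auto intro!: restrict_PiE_iff[THEN iffD2] simp: PiE_iff)
    then have "card {v \<in> I \<rightarrow>\<^sub>E G. Bad i v} \<le> card ((I - {i}) \<rightarrow>\<^sub>E G)"
      using I G by (intro card_inj_on_le[OF inj] finite_PiE) auto
    then show ?thesis using I i by (simp add: card_PiE)
  qed
  have "card G ^ card I = card (I \<rightarrow>\<^sub>E G)" using I by (simp add: card_PiE)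
  also have "\<dots> \<le> card (\<Union>i\<in>I. {v \<in> I \<rightarrow>\<^sub>E G. Bad i v})"
    using I fin by (intro card_mono[OF _ cover]) auto
  also have "\<dots> \<le> (\<Sum>i\<in>I. card {v \<in> I \<rightarrow>\<^sub>E G. Bad i v})" by (rule card_UN_le[OF I])
  also have "\<dots> \<le> (\<Sum>i\<in>I. card G ^ (card I - 1))" by (intro sum_mono le)
  finally have b: "card G ^ card I \<le> card I * card G ^ (card I - 1)" by simp
  show False
  proof (cases "card I")
    case 0
    then show False using b by simp
  next
    case (Suc m)
    then have "card I * card G ^ m < card G * card G ^ m"
      using G(2) by (intro mult_strict_right_mono) auto
    then show False using b Suc by simp
  qed
qed

text \<open>A square matrix of size \<open>K + 1\<close>: the block of \<open>T\<close> scaled by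
  \<open>1 - s\<close>, bordered by the column formed by \<open>w\<close> and a final 1. It is not
  restricted to \<open>lp p\<close>, so that linearity holds for all sequences.\<close>

definition lp_bump ::
    "real \<Rightarrow> nat \<Rightarrow> ((nat \<Rightarrow> complex) \<Rightarrow> nat \<Rightarrow> complex) \<Rightarrow> (nat \<Rightarrow> complex) \<Rightarrow> (nat \<Rightarrow> complex) \<Rightarrow> nat \<Rightarrow> complex"
  where "lp_bump s K T w x = (\<lambda>n. if n < K then of_real (1 - s) * T (lp_cut K x) n + x K * w n
    else if n = K then x K else 0)"

text \<open>This is \<open>lp_opnorm p (lp_bump s K T w)\<close>, the factor by which the bump is
  normalised.\<close>

definition lp_bump_norm ::
    "real \<Rightarrow> real \<Rightarrow> nat \<Rightarrow> ((nat \<Rightarrow> complex) \<Rightarrow> nat \<Rightarrow> complex) \<Rightarrow> (nat \<Rightarrow> complex) \<Rightarrow> real" where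
  "lp_bump_norm p s K T w = (SUP x\<in>{x \<in> lp p. lp_norm p x \<le> 1}. lp_norm p (lp_bump s K T w x))"

context
  fixes p s :: real and K :: nat and T
  assumes p: "p > 1" and s: "0 < s" "s < 1" and T: "T \<in> lp_contractions p"
begin

lemma p_bounds: "p > 0" "p \<ge> 1"
  using p by auto

lemma lp_bump_in: "lp_bump s K T w x \<in> lp p"
proof -
  have "lp_bump s K T w x = lp_cut (Suc K) (lp_bump s K T w x)" by (auto simp: lp_bump_def lp_cut_def)
  then show ?thesis by (metis lp_cut_in)
qed

lemma lp_bump_cut: "lp_bump s K T w (lp_cut (Suc K) x) = lp_bump s K T w x"
proof -
  have "lp_cut K (lp_cut (Suc K) x) = lp_cut K x" by (auto simp: lp_cut_def)
  then show ?thesis by (auto simp: lp_bump_def lp_cut_def[of "Suc K"])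
qed

lemma lp_bump_add: "lp_bump s K T w (\<lambda>n. x n + y n) = (\<lambda>n. lp_bump s K T w x n + lp_bump s K T w y n)"
proof -
  have "lp_cut K (\<lambda>n. x n + y n) = (\<lambda>n. lp_cut K x n + lp_cut K y n)" by (auto simp: lp_cut_def)
  then have "T (lp_cut K (\<lambda>n. x n + y n)) = (\<lambda>n. T (lp_cut K x) n + T (lp_cut K y) n)"
    by (simp add: lp_contractionD(3)[OF T] lp_cut_in)
  then show ?thesis by (auto simp: lp_bump_def algebra_simps)
qed

lemma lp_bump_scale: "lp_bump s K T w (\<lambda>n. c * x n) = (\<lambda>n. c * lp_bump s K T w x n)"
proof -
  have "lp_cut K (\<lambda>n. c * x n) = (\<lambda>n. c * lp_cut K x n)" by (auto simp: lp_cut_def)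
  then have "T (lp_cut K (\<lambda>n. c * x n)) = (\<lambda>n. c * T (lp_cut K x) n)"
    by (simp add: lp_contractionD(4)[OF T] lp_cut_in)
  then show ?thesis by (auto simp: lp_bump_def algebra_simps)
qed

lemma lp_norm_cut_contraction:
  assumes x: "x \<in> lp p"
  shows "lp_norm p (\<lambda>n. of_real (1 - s) * lp_cut K (T (lp_cut K x)) n) \<le> (1 - s) * lp_norm p (lp_cut K x)"
proof -
  have "lp_norm p (lp_cut K (T (lp_cut K x))) \<le> lp_norm p (lp_cut K x)"
    using lp_norm_cut_le[OF p_bounds(1) lp_contractionD(2)[OF T lp_cut_in]]
      lp_contraction_norm[OF p_bounds(2) T lp_cut_in] by (rule order_trans)
  moreover have "norm (complex_of_real (1 - s)) = 1 - s" using s by (simp only: norm_of_real abs_of_pos)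
  ultimately show ?thesis
    using s by (subst lp_norm_scale[OF p_bounds(1) lp_cut_in]) (simp add: mult_left_mono)
qed

text \<open>The block has norm at most \<open>1 - s\<close>, so any excess of the image over
  \<open>1 - s\<close> is due to column \<open>K\<close>. Hence an image of norm near 1 forces a
  lower bound on \<open>norm (x K)\<close>.\<close>

lemma lp_norm_bump_last:
  assumes x: "x \<in> lp p" "lp_norm p x \<le> 1"
  shows "lp_norm p (lp_bump s K T w x) \<le> (1 - s) + norm (x K) * (1 + (\<Sum>n<K. norm (w n)))"
proof -
  let ?a = "\<lambda>n. of_real (1 - s) * lp_cut K (T (lp_cut K x)) n"
    and ?z = "\<lambda>n. lp_cut K w n + lp_unit K n"
  have z: "?z \<in> lp p" "lp_norm p ?z \<le> 1 + (\<Sum>n<K. norm (w n))"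
    using lp_add_triangle[OF p_bounds(2) lp_cut_in[of K w] lp_unit_in[of K]]
      lp_norm_unit[OF p_bounds(1)] lp_norm_cut_sum[OF p_bounds(2), of K w] by auto
  have "lp_bump s K T w x = (\<lambda>n. ?a n + x K * ?z n)"
    by (auto simp: lp_bump_def lp_cut_def[of K "T (lp_cut K x)"] lp_cut_def[of K w] lp_unit_def)
  then have "lp_norm p (lp_bump s K T w x) \<le> lp_norm p ?a + norm (x K) * lp_norm p ?z"
    using lp_add_triangle[OF p_bounds(2) lp_scale[OF lp_cut_in] lp_scale[OF z(1)]]
      lp_norm_scale[OF p_bounds(1) z(1)] by metis
  also have "\<dots> \<le> (1 - s) * 1 + norm (x K) * (1 + (\<Sum>n<K. norm (w n)))"
    using lp_norm_cut_contraction[OF x(1)] lp_norm_cut_le[OF p_bounds(1) x(1), of K] x(2) s z(2)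
    by (intro add_mono mult_left_mono) (auto intro: order_trans mult_left_le)
  finally show ?thesis by simp
qed

text \<open>Without \<open>w\<close> the operator is block diagonal with contractive blocks, hence a
  contraction by disjointness of supports; the entries of \<open>w\<close> then add at most the sum
  of their moduli.\<close>

lemma lp_norm_bump_le:
  assumes x: "x \<in> lp p" "lp_norm p x \<le> 1"
  shows "lp_norm p (lp_bump s K T w x) \<le> 1 + (\<Sum>n<K. norm (w n))"
proof -
  let ?a = "\<lambda>n. of_real (1 - s) * lp_cut K (T (lp_cut K x)) n"
    and ?b = "\<lambda>n. x K * lp_unit K n"
  have b: "?b \<in> lp p" by (intro lp_scale lp_unit_in)
  have dj: "?a n = 0 \<or> ?b n = 0" for n by (auto simp: lp_cut_def lp_unit_def)
  have dj': "lp_cut K x n = 0 \<or> ?b n = 0" for n by (auto simp: lp_cut_def lp_unit_def)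
  note D = lp_norm_disjoint[OF p_bounds(1) lp_scale[OF lp_cut_in] b dj]
  note D' = lp_norm_disjoint[OF p_bounds(1) lp_cut_in b dj']
  have "(1 - s) * lp_norm p (lp_cut K x) \<le> 1 * lp_norm p (lp_cut K x)"
    using s by (intro mult_right_mono) auto
  then have "lp_norm p ?a \<le> lp_norm p (lp_cut K x)"
    using lp_norm_cut_contraction[OF x(1)] by linarith
  then have "lp_norm p (\<lambda>n. ?a n + ?b n) powr p \<le> lp_norm p (lp_cut K x) powr p + lp_norm p ?b powr p"
    unfolding D(2) using p_bounds by (intro add_mono powr_mono2) auto
  also have "\<dots> = lp_norm p (lp_cut (Suc K) x) powr p" by (simp add: D'(2) lp_cut_Suc)
  also have "\<dots> \<le> 1 powr p"
    using lp_norm_cut_le[OF p_bounds(1) x(1), of "Suc K"] x(2) p_bounds by (intro powr_mono2) auto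
  finally have ab: "lp_norm p (\<lambda>n. ?a n + ?b n) \<le> 1"
    by (subst lp_norm_le_iff_powr) (use p_bounds in auto)
  have "lp_bump s K T w x = (\<lambda>n. (?a n + ?b n) + x K * lp_cut K w n)"
    by (auto simp: lp_bump_def lp_cut_def[of K "T (lp_cut K x)"] lp_cut_def[of K w] lp_unit_def)
  then have "lp_norm p (lp_bump s K T w x) \<le> lp_norm p (\<lambda>n. ?a n + ?b n) + norm (x K) * lp_norm p (lp_cut K w)"
    using lp_add_triangle[OF p_bounds(2) D(1) lp_scale[OF lp_cut_in[of K w], of "x K"]]
    by (simp add: lp_norm_scale[OF p_bounds(1) lp_cut_in])
  also have "\<dots> \<le> 1 + 1 * (\<Sum>n<K. norm (w n))"
    using ab lp_norm_coord[OF p_bounds(1) x(1), of K] x(2) lp_norm_cut_sum[OF p_bounds(2), of K w]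
    by (intro add_mono mult_mono) auto
  finally show ?thesis by simp
qed

lemma lp_bump_bdd: "bdd_above ((\<lambda>x. lp_norm p (lp_bump s K T w x)) ` {x \<in> lp p. lp_norm p x \<le> 1})"
  using lp_norm_bump_le by (auto simp: bdd_above_def)

lemma lp_bump_norm_upper:
  "x \<in> lp p \<Longrightarrow> lp_norm p x \<le> 1 \<Longrightarrow> lp_norm p (lp_bump s K T w x) \<le> lp_bump_norm p s K T w"
  unfolding lp_bump_norm_def by (rule cSUP_upper[OF _ lp_bump_bdd]) auto

lemma lp_unit_ball_nonempty: "{x \<in> lp p. lp_norm p x \<le> 1} \<noteq> {}"
  using zero_in_lp[of p] lp_norm_zero[OF p_bounds(1)] by force

lemma lp_bump_norm_le: "lp_bump_norm p s K T w \<le> 1 + (\<Sum>n<K. norm (w n))"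
  unfolding lp_bump_norm_def by (rule cSUP_least[OF lp_unit_ball_nonempty]) (use lp_norm_bump_le in auto)

lemma lp_bump_norm_ge: "1 \<le> lp_bump_norm p s K T w"
proof -
  have "1 = norm (lp_bump s K T w (lp_unit K) K)" by (simp add: lp_bump_def lp_unit_def)
  also have "\<dots> \<le> lp_norm p (lp_bump s K T w (lp_unit K))"
    by (rule lp_norm_coord[OF p_bounds(1) lp_bump_in])
  also have "\<dots> \<le> lp_bump_norm p s K T w"
    by (intro lp_bump_norm_upper lp_unit_in) (simp add: lp_norm_unit[OF p_bounds(1)])
  finally show ?thesis .
qed

lemma lp_bump_near:
  assumes "\<gamma> > 0"
  shows "\<exists>x\<in>lp p. lp_norm p x \<le> 1 \<and> lp_bump_norm p s K T w - \<gamma> \<le> lp_norm p (lp_bump s K T w x)"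
proof -
  have "lp_bump_norm p s K T w - \<gamma> < (SUP x\<in>{x \<in> lp p. lp_norm p x \<le> 1}. lp_norm p (lp_bump s K T w x))"
    using assms by (simp add: lp_bump_norm_def)
  then show ?thesis
    unfolding less_cSUP_iff[OF lp_unit_ball_nonempty lp_bump_bdd] by (auto intro: less_imp_le)
qed

text \<open>
  Almost norming vectors must have a large \<open>K\<close>-th coordinate, because the operator without its
  \<open>K\<close>-th column is a strict contraction. If moreover their images have small \<open>j\<close>-th coordinate, any
  change of \<open>w j\<close> makes these images longer.
\<close>

lemma lp_bump_norm_less:
  assumes j: "j < K" and off: "\<And>k. k < K \<Longrightarrow> k \<noteq> j \<Longrightarrow> w' k = w k" and ne: "w' j \<noteq> w j"
    and bad: "\<And>c. c > 0 \<Longrightarrow> \<exists>x\<in>lp p. lp_norm p x \<le> 1 \<and>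
      lp_bump_norm p s K T w - c \<le> lp_norm p (lp_bump s K T w x) \<and> norm (lp_bump s K T w x j) < c"
  shows "lp_bump_norm p s K T w < lp_bump_norm p s K T w'"
proof -
  let ?N = "lp_bump_norm p s K T w" and ?N' = "lp_bump_norm p s K T w'"
  define W where "W = 1 + (\<Sum>n<K. norm (w n))"
  have W: "W \<ge> 1" by (simp add: W_def sum_nonneg)
  \<comment> \<open>Lower bound for the change of the \<open>j\<close>-th coordinate of the image
    when \<open>w\<close> is replaced by \<open>w'\<close>: the factor \<open>s / 2 / W\<close>
    bounds \<open>norm (x K)\<close> from below.\<close>
  define D where "D = norm (w' j - w j) * (s / 2 / W)"
  have D: "D > 0" using ne s W by (simp add: D_def)
  \<comment> \<open>In the image of an almost norming \<open>x\<close>, a \<open>j\<close>-th term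
    of at most \<open>c powr p\<close> is replaced by one of at least \<open>(D - c) powr p\<close>,
    all others being unchanged. Letting \<open>c\<close> tend to 0 yields the gain
    \<open>D powr p\<close>.\<close>
  have ineq: "(?N - c) powr p - c powr p + (D - c) powr p \<le> ?N' powr p"
    if c: "0 < c" "c < s / 2" "c < D" for c
  proof -
    obtain x where x: "x \<in> lp p" "lp_norm p x \<le> 1" "?N - c \<le> lp_norm p (lp_bump s K T w x)"
        "norm (lp_bump s K T w x j) < c"
      using bad[OF c(1)] by blast
    have N1: "?N \<ge> 1" by (rule lp_bump_norm_ge)
    have "s / 2 \<le> norm (x K) * W"
      using lp_norm_bump_last[OF x(1,2), of w] x(3) N1 c(2) by (simp add: W_def)
    then have "s / 2 / W \<le> norm (x K)" using W by (simp add: divide_le_eq)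
    then have Dx: "D \<le> norm (w' j - w j) * norm (x K)" unfolding D_def by (intro mult_left_mono) auto
    have "lp_bump s K T w' x j = lp_bump s K T w x j + (w' j - w j) * x K"
      using j by (simp add: lp_bump_def algebra_simps)
    then have "norm ((w' j - w j) * x K) \<le> norm (lp_bump s K T w' x j) + norm (lp_bump s K T w x j)"
      using norm_triangle_ineq4[of "lp_bump s K T w' x j" "lp_bump s K T w x j"] by simp
    then have Dc: "D - c \<le> norm (lp_bump s K T w' x j)" using Dx x(4) by (simp add: norm_mult)
    have "lp_norm p (lp_bump s K T w' x) powr p - norm (lp_bump s K T w' x j) powr p
        = lp_norm p (lp_bump s K T w x) powr p - norm (lp_bump s K T w x j) powr p"
      by (rule lp_norm_powr_update[OF p_bounds(1) lp_bump_in lp_bump_in]) (auto simp: lp_bump_def off)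
    moreover have "(?N - c) powr p \<le> lp_norm p (lp_bump s K T w x) powr p"
      using x(3) N1 c(2) s p_bounds by (intro powr_mono2) auto
    moreover have "norm (lp_bump s K T w x j) powr p \<le> c powr p"
      using x(4) p_bounds by (intro powr_mono2) auto
    moreover have "(D - c) powr p \<le> norm (lp_bump s K T w' x j) powr p"
      using Dc c p_bounds by (intro powr_mono2) auto
    moreover have "lp_norm p (lp_bump s K T w' x) powr p \<le> ?N' powr p"
      using lp_bump_norm_upper[OF x(1,2), of w'] p_bounds by (intro powr_mono2) auto
    ultimately show ?thesis by linarith
  qed
  have cont: "((\<lambda>c. (a - c) powr p) \<longlongrightarrow> (a - 0) powr p) (at_right 0)" if "a > 0" for a
    using that by (intro tendsto_intros) auto
  have "((\<lambda>c::real. c powr p) \<longlongrightarrow> 0) (at_right 0)"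
    using p_bounds by (intro tendsto_zero_powrI) (auto simp: eventually_at_filter)
  then have "((\<lambda>c. (?N - c) powr p - c powr p + (D - c) powr p) \<longlongrightarrow> (?N - 0) powr p - 0 + (D - 0) powr p) (at_right 0)"
    using D lp_bump_norm_ge[of w] by (intro tendsto_add tendsto_diff cont) auto
  moreover have "eventually (\<lambda>c. c \<in> {0<..<min (s / 2) D}) (at_right 0)"
    using s D by (intro eventually_at_right_real) simp
  then have "eventually (\<lambda>c. (?N - c) powr p - c powr p + (D - c) powr p \<le> ?N' powr p) (at_right 0)"
    by (rule eventually_mono) (use ineq in auto)
  ultimately have "(?N - 0) powr p - 0 + (D - 0) powr p \<le> ?N' powr p"
    by (rule tendsto_upperbound) simp
  moreover have "D powr p > 0" using D by simp
  ultimately have "?N powr p < ?N' powr p" unfolding diff_zero by linarith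
  then show ?thesis
    using powr_mono2[of p ?N' ?N] p_bounds lp_bump_norm_ge[of w'] by force
qed

text \<open>If two columns differing only at \<open>j\<close> were both bad at \<open>j\<close>,
  each of the two norms would be strictly less than the other. So the counting lemma applies to a
  grid of columns.\<close>

lemma lp_bump_good:
  assumes \<sigma>: "\<sigma> > 0"
  obtains w c where "(\<Sum>n<K. norm (w n)) \<le> \<sigma>" "c > 0"
    "\<And>x j. x \<in> lp p \<Longrightarrow> lp_norm p x \<le> 1 \<Longrightarrow>
      lp_bump_norm p s K T w - c \<le> lp_norm p (lp_bump s K T w x) \<Longrightarrow> j < K \<Longrightarrow> c \<le> norm (lp_bump s K T w x j)"
proof -
  define Bad where "Bad j w \<longleftrightarrow> (\<forall>c>0. \<exists>x\<in>lp p. lp_norm p x \<le> 1 \<and>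
      lp_bump_norm p s K T w - c \<le> lp_norm p (lp_bump s K T w x) \<and> norm (lp_bump s K T w x j) < c)" for j w
  \<comment> \<open>Grid step: the \<open>K\<close> entries have modulus at most
    \<open>\<tau> * real K\<close> each, so their moduli sum to at most
    \<open>\<sigma>\<close>.\<close>
  define \<tau> where "\<tau> = \<sigma> / (real K + 1) ^ 2"
  have tau: "\<tau> > 0" using \<sigma> by (simp add: \<tau>_def)
  define G where "G = (\<lambda>l. complex_of_real (\<tau> * real l)) ` {..K}"
  have "card G = Suc K" using tau by (simp add: G_def card_image inj_on_def)
  then have "card {..<K} < card G" by simp
  then have "\<exists>w\<in>{..<K} \<rightarrow>\<^sub>E G. \<forall>j\<in>{..<K}. \<not> Bad j w"
  proof (intro exists_PiE_avoiding)
    fix j w w' assume "j \<in> {..<K}" and B: "Bad j w" "Bad j w'"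
      and e: "\<And>k. k \<in> {..<K} \<Longrightarrow> k \<noteq> j \<Longrightarrow> w k = w' k"
    then have j: "j < K" by simp
    show "w j = w' j"
    proof (rule ccontr)
      assume ne: "w j \<noteq> w' j"
      have "lp_bump_norm p s K T w < lp_bump_norm p s K T w'"
        by (rule lp_bump_norm_less[OF j]) (use e ne B(1) in \<open>auto simp: Bad_def\<close>)
      moreover have "lp_bump_norm p s K T w' < lp_bump_norm p s K T w"
        by (rule lp_bump_norm_less[OF j]) (use e ne B(2) in \<open>auto simp: Bad_def\<close>)
      ultimately show False by simp
    qed
  qed (auto simp: G_def)
  then obtain w where w: "w \<in> {..<K} \<rightarrow>\<^sub>E G" "\<And>j. j < K \<Longrightarrow> \<not> Bad j w" by auto
  have "norm (w n) \<le> \<tau> * real K" if "n < K" for n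
  proof -
    have "w n \<in> G" using w(1) that by auto
    then obtain l where "l \<le> K" "w n = complex_of_real (\<tau> * real l)" by (auto simp: G_def)
    then show ?thesis using tau by (simp add: norm_mult)
  qed
  then have "(\<Sum>n<K. norm (w n)) \<le> (\<Sum>n<K. \<tau> * real K)" by (intro sum_mono) auto
  also have "\<dots> = \<tau> * real K ^ 2" by (simp add: power2_eq_square)
  also have "\<dots> \<le> \<tau> * (real K + 1) ^ 2" using tau by (intro mult_left_mono power_mono) auto
  also have "\<dots> = \<sigma>" by (simp add: \<tau>_def)
  finally have W: "(\<Sum>n<K. norm (w n)) \<le> \<sigma>" .
  have "\<forall>j\<in>{..<K}. \<exists>c>0. \<forall>x\<in>lp p. lp_norm p x \<le> 1 \<longrightarrow>
      lp_bump_norm p s K T w - c \<le> lp_norm p (lp_bump s K T w x) \<longrightarrow> c \<le> norm (lp_bump s K T w x j)"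
    using w(2) unfolding Bad_def by (metis lessThan_iff linorder_not_less)
  then obtain c where c: "\<And>j. j < K \<Longrightarrow> c j > 0"
    "\<And>j x. j < K \<Longrightarrow> x \<in> lp p \<Longrightarrow> lp_norm p x \<le> 1 \<Longrightarrow>
      lp_bump_norm p s K T w - c j \<le> lp_norm p (lp_bump s K T w x) \<Longrightarrow> c j \<le> norm (lp_bump s K T w x j)"
    unfolding bchoice_iff by auto
  \<comment> \<open>Inserting 1 keeps the minimum meaningful when \<open>K = 0\<close>.\<close>
  define c0 where "c0 = Min (insert 1 (c ` {..<K}))"
  have c0: "c0 > 0" "\<And>j. j < K \<Longrightarrow> c0 \<le> c j" using c(1) by (auto simp: c0_def)
  show ?thesis
  proof (rule that[OF W c0(1)])
    fix x j assume x: "x \<in> lp p" "lp_norm p x \<le> 1"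
      "lp_bump_norm p s K T w - c0 \<le> lp_norm p (lp_bump s K T w x)" and j: "j < K"
    show "c0 \<le> norm (lp_bump s K T w x j)"
      using c(2)[OF j x(1,2)] c0(2)[OF j] x(3) by linarith
  qed
qed

end

text \<open>\<open>B\<close> is the bump divided by its norm. A large \<open>K\<close> captures most
  of the first \<open>n\<close> columns and rows of \<open>T\<close>; the good column from
  \<open>lp_bump_good\<close> supplies what \<open>lp_contraction_rigid\<close> asks of
  \<open>B\<close>.\<close>

lemma lp_contraction_perturb:
  assumes p: "p > 1" and T: "T \<in> lp_contractions p" and e: "\<epsilon> > 0"
  obtains B m c where "B \<in> lp_contractions p" "\<And>x. x \<in> lp p \<Longrightarrow> B (lp_cut m x) = B x" "c > 0"
    "\<And>i. i < n \<Longrightarrow> lp_norm p (\<lambda>k. B (lp_unit i) k - T (lp_unit i) k) \<le> \<epsilon>"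
    "\<And>j y. j < n \<Longrightarrow> y \<in> lp p \<Longrightarrow> lp_norm p y \<le> 1 \<Longrightarrow> norm (B y j - T y j) \<le> \<epsilon>"
    "\<And>x j. x \<in> lp p \<Longrightarrow> lp_norm p x \<le> 1 \<Longrightarrow> 1 - c \<le> lp_norm p (B x) \<Longrightarrow> j < n \<Longrightarrow> c \<le> norm (B x j)"
    "\<And>\<gamma>. \<gamma> > 0 \<Longrightarrow> \<exists>x\<in>lp p. lp_norm p x \<le> 1 \<and> 1 - \<gamma> \<le> lp_norm p (B x)"
proof -
  have p0: "p > 0" and p1: "p \<ge> 1" using p by auto
  have "eventually (\<lambda>K. lp_norm p (\<lambda>k. T (lp_unit i) k - lp_cut K (T (lp_unit i)) k) < \<epsilon> / 2) sequentially" for i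
    using lp_tail_tendsto[OF p0 lp_contractionD(2)[OF T lp_unit_in]] e by (intro order_tendstoD(2)) auto
  then have ev1: "eventually (\<lambda>K. \<forall>i\<in>{..<n}.
      lp_norm p (\<lambda>k. T (lp_unit i) k - lp_cut K (T (lp_unit i)) k) < \<epsilon> / 2) sequentially"
    by (intro eventually_ball_finite) auto
  have "eventually (\<lambda>K. \<forall>y\<in>lp p. lp_norm p y \<le> 1 \<longrightarrow> (\<forall>i<K. y i = 0) \<longrightarrow> norm (T y j) \<le> \<epsilon> / 4) sequentially" for j
  proof -
    obtain m where m: "\<And>y. y \<in> lp p \<Longrightarrow> lp_norm p y \<le> 1 \<Longrightarrow> (\<And>i. i < m \<Longrightarrow> y i = 0) \<Longrightarrow>
        norm ((\<lambda>x\<in>lp p. T x j) y) \<le> \<epsilon> / 4"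
      using lp_dual_tail[OF p coord_in_lp_dual[OF p1 T, of j], of "\<epsilon> / 4"] e by auto
    show ?thesis
      using eventually_ge_at_top[of m]
    proof (rule eventually_mono, intro ballI impI)
      fix K y assume "m \<le> K" "y \<in> lp p" "lp_norm p y \<le> 1" "\<forall>i<K. y i = 0"
      then show "norm (T y j) \<le> \<epsilon> / 4" using m[of y] by simp
    qed
  qed
  then have ev2: "eventually (\<lambda>K. \<forall>j\<in>{..<n}. \<forall>y\<in>lp p. lp_norm p y \<le> 1 \<longrightarrow> (\<forall>i<K. y i = 0) \<longrightarrow>
      norm (T y j) \<le> \<epsilon> / 4) sequentially"
    by (intro eventually_ball_finite) auto
  obtain K where K: "n \<le> K"
    "\<And>i. i < n \<Longrightarrow> lp_norm p (\<lambda>k. T (lp_unit i) k - lp_cut K (T (lp_unit i)) k) < \<epsilon> / 2"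
    "\<And>j y. j < n \<Longrightarrow> y \<in> lp p \<Longrightarrow> lp_norm p y \<le> 1 \<Longrightarrow> (\<forall>i<K. y i = 0) \<Longrightarrow> norm (T y j) \<le> \<epsilon> / 4"
    using eventually_happens[OF eventually_conj[OF eventually_ge_at_top[of n] eventually_conj[OF ev1 ev2]]]
    by auto
  \<comment> \<open>\<open>s\<close> bounds both the shrinking of the block and the size of
    \<open>w\<close>. The total error is then at most \<open>2 * s + \<epsilon> / 2\<close> for
    columns and \<open>3 * s + \<epsilon> / 4\<close> for rows.\<close>
  define s where "s = min (1 / 4) (\<epsilon> / 8)"
  have s: "0 < s" "s < 1" "s \<le> \<epsilon> / 8" using e by (auto simp: s_def)
  note bump = p s(1,2) T
  obtain w c where w: "(\<Sum>n<K. norm (w n)) \<le> s" and c: "c > 0"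
    and good: "\<And>x j. x \<in> lp p \<Longrightarrow> lp_norm p x \<le> 1 \<Longrightarrow>
      lp_bump_norm p s K T w - c \<le> lp_norm p (lp_bump s K T w x) \<Longrightarrow> j < K \<Longrightarrow> c \<le> norm (lp_bump s K T w x j)"
    using lp_bump_good[OF bump s(1)] by blast
  define N where "N = lp_bump_norm p s K T w"
  have N: "1 \<le> N" "N \<le> 1 + s"
    using lp_bump_norm_ge[OF bump, of K w] lp_bump_norm_le[OF bump, of K w] w by (auto simp: N_def)
  define r where "r = complex_of_real (1 / N)"
  have nr: "norm r = 1 / N" using N by (simp add: r_def norm_divide)
  define f where "f x = (\<lambda>k. r * lp_bump s K T w x k)" for x
  define B where "B = restrict f (lp p)"
  have nf: "lp_norm p (f x) = lp_norm p (lp_bump s K T w x) / N" for x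
    by (simp add: f_def lp_norm_scale[OF p0 lp_bump_in[OF bump]] nr)
  have B: "B \<in> lp_contractions p"
    unfolding B_def
  proof (rule lp_contractionI[OF p1])
    show "f x \<in> lp p" for x unfolding f_def by (intro lp_scale lp_bump_in[OF bump])
    show "f (\<lambda>k. x k + y k) = (\<lambda>k. f x k + f y k)" for x y
      by (simp add: f_def lp_bump_add[OF bump] algebra_simps)
    show "f (\<lambda>k. a * x k) = (\<lambda>k. a * f x k)" for a x
      by (simp add: f_def lp_bump_scale[OF bump] mult_ac)
    show "lp_norm p (f x) \<le> 1" if "x \<in> lp p" "lp_norm p x \<le> 1" for x
      using lp_bump_norm_upper[OF bump that, of K w] N by (simp add: nf N_def divide_le_eq)
  qed
  \<comment> \<open>The net factor on the block of \<open>T\<close> after scaling and normalisation.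
    It is within \<open>2 * s\<close> of 1 because \<open>N \<le> 1 + s\<close> and
    \<open>(1 - 2 * s) * (1 + s) \<le> 1 - s\<close>.\<close>
  define q where "q = (1 - s) / N"
  have q: "0 \<le> q" "q \<le> 1" "1 - q \<le> 2 * s"
  proof -
    show "0 \<le> q" "q \<le> 1" using s N by (auto simp: q_def)
    have "(1 - 2 * s) * N \<le> (1 - 2 * s) * (1 + s)" using N s by (intro mult_left_mono) (auto simp: s_def)
    also have "\<dots> \<le> 1 - s" using s by (simp add: algebra_simps)
    finally show "1 - q \<le> 2 * s" using N by (simp add: q_def field_simps)
  qed
  have nq: "norm (complex_of_real q - 1) \<le> 2 * s"
    using q by (metis abs_minus_commute abs_of_nonneg diff_ge_0_iff_ge norm_of_real of_real_1 of_real_diff)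
  have rq: "r * of_real (1 - s) = of_real q" by (simp add: r_def q_def)
  show ?thesis
  \<comment> \<open>The cut is at \<open>Suc K\<close> because column \<open>K\<close> carries
    \<open>w\<close>. Multiplying by \<open>N\<close> turns the threshold \<open>c / N\<close> for
    \<open>B\<close> into \<open>c\<close> for the bump.\<close>
  proof (rule that[OF B, of "Suc K" "c / N"])
    show "B (lp_cut (Suc K) x) = B x" if "x \<in> lp p" for x
      using that by (simp add: B_def lp_cut_in f_def lp_bump_cut[OF bump])
    show "c / N > 0" using c N by simp
  next
    fix i assume i: "i < n"
    let ?t = "T (lp_unit i)"
    have t: "?t \<in> lp p" by (intro lp_contractionD(2)[OF T] lp_unit_in)
    have "lp_cut K (lp_unit i) = lp_unit i" "lp_unit i K = 0"
      using i K(1) by (auto simp: lp_cut_def lp_unit_def)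
    then have "lp_bump s K T w (lp_unit i) = (\<lambda>k. of_real (1 - s) * lp_cut K ?t k)"
      by (auto simp: lp_bump_def lp_cut_def[of K ?t])
    then have "B (lp_unit i) = (\<lambda>k. of_real q * lp_cut K ?t k)"
      by (simp add: B_def lp_unit_in f_def mult.assoc[symmetric] rq del: of_real_diff)
    then have eq: "(\<lambda>k. B (lp_unit i) k - ?t k) = (\<lambda>k. (of_real q - 1) * lp_cut K ?t k - (?t k - lp_cut K ?t k))"
      by (simp add: algebra_simps)
    have "lp_norm p (\<lambda>k. B (lp_unit i) k - ?t k)
        \<le> lp_norm p (\<lambda>k. (of_real q - 1) * lp_cut K ?t k) + lp_norm p (\<lambda>k. ?t k - lp_cut K ?t k)"
      unfolding eq by (rule lp_diff_triangle[OF p1 lp_scale[OF lp_cut_in] lp_tail_in[OF p1 t]])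
    moreover have "lp_norm p (\<lambda>k. (of_real q - 1) * lp_cut K ?t k) \<le> 2 * s * 1"
      unfolding lp_norm_scale[OF p0 lp_cut_in]
      using lp_norm_cut_le[OF p0 t, of K] lp_contraction_norm[OF p1 T lp_unit_in, of i] lp_norm_unit[OF p0, of i] nq s
      by (intro mult_mono) auto
    ultimately show "lp_norm p (\<lambda>k. B (lp_unit i) k - ?t k) \<le> \<epsilon>" using K(2)[OF i] s by linarith
  next
    fix j y assume j: "j < n" and y: "y \<in> lp p" "lp_norm p y \<le> 1"
    let ?u = "lp_cut K y" and ?v = "\<lambda>k. y k - lp_cut K y k"
    have "B y j = of_real q * T ?u j + r * (y K * w j)"
      using j K(1) y by (simp add: B_def f_def lp_bump_def distrib_left mult.assoc[symmetric] rq del: of_real_diff)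
    then have "B y j - T y j = (of_real q - 1) * T ?u j + r * (y K * w j) - T ?v j"
      using lp_contraction_cut_tail[OF p1 T y(1), of j K] by (simp add: algebra_simps)
    then have "norm (B y j - T y j) \<le> norm ((of_real q - 1) * T ?u j) + norm (r * (y K * w j)) + norm (T ?v j)"
      using norm_triangle_ineq4[of "(of_real q - 1) * T ?u j + r * (y K * w j)" "T ?v j"]
        norm_triangle_ineq[of "(of_real q - 1) * T ?u j" "r * (y K * w j)"] by simp
    moreover have "norm ((of_real q - 1) * T ?u j) \<le> 2 * s * 1"
      unfolding norm_mult
    proof (intro mult_mono nq)
      show "norm (T ?u j) \<le> 1"
        using lp_norm_coord[OF p0 lp_contractionD(2)[OF T lp_cut_in], of K y j]
          lp_contraction_norm[OF p1 T lp_cut_in, of K y] lp_norm_cut_le[OF p0 y(1), of K] y(2) by linarith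
    qed (use s in auto)
    moreover have "norm (r * (y K * w j)) \<le> 1 * (1 * s)"
      unfolding norm_mult
    proof (intro mult_mono)
      show "norm (y K) \<le> 1" using lp_norm_coord[OF p0 y(1), of K] y(2) by linarith
      have "norm (w j) \<le> (\<Sum>n<K. norm (w n))" using j K(1) by (intro member_le_sum) auto
      then show "norm (w j) \<le> s" using w by linarith
    qed (use nr N s in auto)
    moreover have "norm (T ?v j) \<le> \<epsilon> / 4"
      using lp_norm_tail_le[OF p0 y(1), of K] y(2)
      by (intro K(3)[OF j lp_tail_in[OF p1 y(1)]]) (auto simp: lp_cut_def)
    ultimately show "norm (B y j - T y j) \<le> \<epsilon>" using s by linarith
  next
    fix x j assume x: "x \<in> lp p" "lp_norm p x \<le> 1" "1 - c / N \<le> lp_norm p (B x)" and j: "j < n"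
    have "N - c \<le> lp_norm p (lp_bump s K T w x)"
    proof -
      have "(1 - c / N) * N \<le> lp_norm p (lp_bump s K T w x) / N * N"
        using x(1,3) N by (intro mult_right_mono) (simp_all add: B_def nf)
      then show ?thesis using N by (simp add: left_diff_distrib)
    qed
    then have "c \<le> norm (lp_bump s K T w x j)"
      using good[OF x(1,2)] j K(1) by (simp add: N_def)
    then show "c / N \<le> norm (B x j)"
      using x(1) N by (simp add: B_def f_def norm_mult nr divide_right_mono)
  next
    fix \<gamma> :: real assume "\<gamma> > 0"
    then obtain x where x: "x \<in> lp p" "lp_norm p x \<le> 1" "N - \<gamma> \<le> lp_norm p (lp_bump s K T w x)"
      using lp_bump_near[OF bump, of \<gamma> K w] by (auto simp: N_def)
    have "\<gamma> * 1 \<le> \<gamma> * N" using N \<open>\<gamma> > 0\<close> by (intro mult_left_mono) auto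
    then have "1 - \<gamma> \<le> lp_norm p (B x)"
      using x N by (simp add: B_def nf pos_le_divide_eq left_diff_distrib)
    then show "\<exists>x\<in>lp p. lp_norm p x \<le> 1 \<and> 1 - \<gamma> \<le> lp_norm p (B x)" using x by blast
  qed
qed

section \<open>Openness and density\<close>

lemma lp_contractions_subset: "lp_contractions p \<subseteq> lp_operators p"
  by (auto simp: lp_contractions_def)

text \<open>Each \<open>x\<close> contributes the preimage of a ball under evaluation at
  \<open>x\<close>, and finitely many such sets are intersected.\<close>

lemma openin_SOT_contractions:
  assumes p: "p \<ge> 1" and B: "B \<in> lp_contractions p" and X: "finite X" "X \<subseteq> lp p"
  shows "openin (subtopology (lp_SOT p) (lp_contractions p))
    {S \<in> lp_contractions p. \<forall>x\<in>X. lp_norm p (\<lambda>n. S x n - B x n) < \<delta>}"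
  using X
proof (induction X rule: finite_induct)
  case empty
  have "topspace (subtopology (lp_SOT p) (lp_contractions p)) = lp_contractions p"
    using lp_contractions_subset[of p] by (auto simp: topspace_lp_SOT[OF p])
  then show ?case using openin_topspace[of "subtopology (lp_SOT p) (lp_contractions p)"] by simp
next
  case (insert x X)
  interpret Metric_space "lp p" "lp_dist p" by (rule Metric_space_lp[OF p])
  let ?P = "product_topology (\<lambda>_. lp_topology p) (lp p)"
  have x: "x \<in> lp p" using insert by simp
  have "openin ?P {S \<in> topspace ?P. S x \<in> mball (B x) \<delta>}"
    by (rule openin_continuous_map_preimage[OF continuous_map_product_projection[OF x]])
      (simp add: lp_topology_def)
  moreover have "{S \<in> lp_contractions p. lp_norm p (\<lambda>n. S x n - B x n) < \<delta>}
      = {S \<in> topspace ?P. S x \<in> mball (B x) \<delta>} \<inter> (lp_operators p \<inter> lp_contractions p)"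
    using lp_contractions_subset[of p] lp_operators_subset[OF p] lp_contractionD(2)[OF _ x]
      lp_norm_minus_commute[of p "B x"]
    by (auto simp: mball_def lp_dist_def B)
  ultimately have "openin (subtopology (lp_SOT p) (lp_contractions p))
      {S \<in> lp_contractions p. lp_norm p (\<lambda>n. S x n - B x n) < \<delta>}"
    unfolding lp_SOT_def subtopology_subtopology openin_subtopology by blast
  from openin_Int[OF this insert.IH] insert.prems show ?case
    by (simp add: Collect_conj_eq Int_ac)
qed

text \<open>\<open>V\<close> is an SOT-neighbourhood of a perturbation \<open>B\<close> of
  \<open>T\<close>, in general not of \<open>T\<close> itself: rigidity at \<open>B\<close> upgrades
  SOT-closeness to norm closeness of the first \<open>n\<close> rows. Half of the tolerance goes to
  the perturbation, half to the neighbourhood.\<close>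

lemma SOT_open_approximation:
  assumes p: "p > 2" and T: "T \<in> lp_contractions p" and e: "\<epsilon> > 0"
  obtains V where "openin (subtopology (lp_SOT p) (lp_contractions p)) V" "V \<noteq> {}"
    "\<And>S i. S \<in> V \<Longrightarrow> i < n \<Longrightarrow> lp_norm p (\<lambda>k. S (lp_unit i) k - T (lp_unit i) k) \<le> \<epsilon>"
    "\<And>S j y. S \<in> V \<Longrightarrow> j < n \<Longrightarrow> y \<in> lp p \<Longrightarrow> lp_norm p y \<le> 1 \<Longrightarrow> norm (S y j - T y j) \<le> \<epsilon>"
proof -
  have p0: "p > 0" and p1: "p \<ge> 1" and p1': "p > 1" using p by auto
  have e2: "\<epsilon> / 2 > 0" using e by simp
  obtain B m c where B: "B \<in> lp_contractions p" "\<And>x. x \<in> lp p \<Longrightarrow> B (lp_cut m x) = B x" "c > 0"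
    and col: "\<And>i. i < n \<Longrightarrow> lp_norm p (\<lambda>k. B (lp_unit i) k - T (lp_unit i) k) \<le> \<epsilon> / 2"
    and row: "\<And>j y. j < n \<Longrightarrow> y \<in> lp p \<Longrightarrow> lp_norm p y \<le> 1 \<Longrightarrow> norm (B y j - T y j) \<le> \<epsilon> / 2"
    and good: "\<And>x j. x \<in> lp p \<Longrightarrow> lp_norm p x \<le> 1 \<Longrightarrow> 1 - c \<le> lp_norm p (B x) \<Longrightarrow> j < n \<Longrightarrow> c \<le> norm (B x j)"
    and near: "\<And>\<gamma>. \<gamma> > 0 \<Longrightarrow> \<exists>x\<in>lp p. lp_norm p x \<le> 1 \<and> 1 - \<gamma> \<le> lp_norm p (B x)"
    using lp_contraction_perturb[OF p1' T e2, of n] by blast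
  obtain X \<delta> where X: "finite X" "X \<subseteq> lp p" "\<delta> > 0"
    and rigid: "\<And>S j y. S \<in> lp_contractions p \<Longrightarrow> (\<And>x. x \<in> X \<Longrightarrow> lp_norm p (\<lambda>n. S x n - B x n) < \<delta>) \<Longrightarrow>
      j < n \<Longrightarrow> y \<in> lp p \<Longrightarrow> lp_norm p y \<le> 1 \<Longrightarrow> norm (S y j - B y j) \<le> \<epsilon> / 2"
    using lp_contraction_rigid[OF p B e2 good near, of n] by blast
  let ?X = "X \<union> lp_unit ` {..<n}" and ?d = "min \<delta> (\<epsilon> / 2)"
  define V where "V = {S \<in> lp_contractions p. \<forall>x\<in>?X. lp_norm p (\<lambda>n. S x n - B x n) < ?d}"
  show ?thesis
  proof (rule that[of V])
    show "openin (subtopology (lp_SOT p) (lp_contractions p)) V"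
      unfolding V_def using X lp_unit_in by (intro openin_SOT_contractions p1 B) auto
    have "B \<in> V" using B(1) X(3) e by (simp add: V_def lp_norm_zero[OF p0])
    then show "V \<noteq> {}" by blast
  next
    fix S i assume S: "S \<in> V" and i: "i < n"
    then have Sc: "S \<in> lp_contractions p" by (simp add: V_def)
    have "(\<lambda>k. S (lp_unit i) k - T (lp_unit i) k)
        = (\<lambda>k. (S (lp_unit i) k - B (lp_unit i) k) + (B (lp_unit i) k - T (lp_unit i) k))" by simp
    then have "lp_norm p (\<lambda>k. S (lp_unit i) k - T (lp_unit i) k)
        \<le> lp_norm p (\<lambda>k. S (lp_unit i) k - B (lp_unit i) k) + lp_norm p (\<lambda>k. B (lp_unit i) k - T (lp_unit i) k)"
      using lp_add_triangle[OF p1 lp_contraction_diff_norm(1)[OF p1 Sc B(1) lp_unit_in[of i]]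
          lp_contraction_diff_norm(1)[OF p1 B(1) T lp_unit_in[of i]]] by simp
    moreover have "lp_norm p (\<lambda>k. S (lp_unit i) k - B (lp_unit i) k) < \<epsilon> / 2"
      using S i by (simp add: V_def)
    ultimately show "lp_norm p (\<lambda>k. S (lp_unit i) k - T (lp_unit i) k) \<le> \<epsilon>"
      using col[OF i] by linarith
  next
    fix S j y assume S: "S \<in> V" and j: "j < n" and y: "y \<in> lp p" "lp_norm p y \<le> 1"
    have "norm (S y j - B y j) \<le> \<epsilon> / 2"
      by (rule rigid[OF _ _ j y]) (use S in \<open>auto simp: V_def\<close>)
    then show "norm (S y j - T y j) \<le> \<epsilon>"
      using row[OF j y] norm_triangle_ineq[of "S y j - B y j" "B y j - T y j"] by simp
  qed
qed

text \<open>SOT constrains only the first component of \<open>(T, lp_adjoint p T)\<close>; the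
  second factor may be the whole space.\<close>

lemma openin_SOT_imp_SOT_star:
  assumes p: "p \<ge> 1" and U: "openin (lp_SOT p) U"
  shows "openin (lp_SOT_star p) U"
proof -
  let ?P = "product_topology (\<lambda>_. lp_topology p) (lp p)"
    and ?Q = "product_topology (\<lambda>_. lp_dual_topology p) (lp_dual p)"
  obtain V where V: "openin ?P V" "U = V \<inter> lp_operators p"
    using U by (auto simp: lp_SOT_def openin_subtopology)
  have "openin (prod_topology ?P ?Q) (V \<times> topspace ?Q)"
    using V(1) by (simp add: openin_prod_Times_iff del: topspace_product_topology)
  moreover have "U = (\<lambda>T. (T, lp_adjoint p T)) -` (V \<times> topspace ?Q) \<inter> lp_operators p"
    using V(2) lp_adjoint_in_topspace[OF p] by blast
  ultimately show ?thesis
    unfolding lp_SOT_star_def openin_pullback_topology by blast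
qed

text \<open>If the interior were empty, none of the nonempty SOT-open sets approximating a point
  \<open>T\<close> of \<open>Q\<close> would lie in \<open>Q\<close>. Choosing a point outside
  \<open>Q\<close> from the \<open>n\<close>-th such set gives a sequence that converges to
  \<open>T\<close> in SOT*, against the openness of \<open>Q\<close>.\<close>

lemma SOT_star_open_SOT_interior:
  assumes p: "p > 2" and Q: "openin (subtopology (lp_SOT_star p) (lp_contractions p)) Q" "Q \<noteq> {}"
  shows "subtopology (lp_SOT p) (lp_contractions p) interior_of Q \<noteq> {}"
proof
  assume empty: "subtopology (lp_SOT p) (lp_contractions p) interior_of Q = {}"
  obtain U where U: "openin (lp_SOT_star p) U" "Q = U \<inter> lp_contractions p"
    using Q(1) by (auto simp: openin_subtopology)
  obtain T where T: "T \<in> Q" using Q(2) by blast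
  then have Tc: "T \<in> lp_contractions p" using U by blast
  have "\<exists>S. S \<in> lp_contractions p \<and> S \<notin> Q \<and>
      (\<forall>i<n. lp_norm p (\<lambda>k. S (lp_unit i) k - T (lp_unit i) k) \<le> inverse (real (Suc n))) \<and>
      (\<forall>j<n. \<forall>y\<in>lp p. lp_norm p y \<le> 1 \<longrightarrow> norm (S y j - T y j) \<le> inverse (real (Suc n)))" for n
  proof -
    have "inverse (real (Suc n)) > 0" by simp
    from SOT_open_approximation[OF p Tc this, of n]
    obtain V where V: "openin (subtopology (lp_SOT p) (lp_contractions p)) V" "V \<noteq> {}"
      "\<And>S i. S \<in> V \<Longrightarrow> i < n \<Longrightarrow> lp_norm p (\<lambda>k. S (lp_unit i) k - T (lp_unit i) k) \<le> inverse (real (Suc n))"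
      "\<And>S j y. S \<in> V \<Longrightarrow> j < n \<Longrightarrow> y \<in> lp p \<Longrightarrow> lp_norm p y \<le> 1 \<Longrightarrow>
        norm (S y j - T y j) \<le> inverse (real (Suc n))"
      by blast
    have "\<not> V \<subseteq> Q" using interior_of_maximal[OF _ V(1)] V(2) empty by blast
    then obtain S where "S \<in> V" "S \<notin> Q" by blast
    moreover have "V \<subseteq> lp_contractions p" using openin_subset[OF V(1)] by simp
    ultimately show ?thesis using V(3,4) by blast
  qed
  then obtain S where S: "\<And>n. S n \<in> lp_contractions p" "\<And>n. S n \<notin> Q"
    and col: "\<And>n i. i < n \<Longrightarrow> lp_norm p (\<lambda>k. S n (lp_unit i) k - T (lp_unit i) k) \<le> inverse (real (Suc n))"
    and row: "\<And>n j y. j < n \<Longrightarrow> y \<in> lp p \<Longrightarrow> lp_norm p y \<le> 1 \<Longrightarrow> norm (S n y j - T y j) \<le> inverse (real (Suc n))"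
    by metis
  have "limitin (lp_SOT_star p) S T sequentially"
  proof (rule limitin_SOT_star_contractions[OF _ Tc S(1)])
    show "p > 1" using p by simp
    show "(\<lambda>n. lp_norm p (\<lambda>k. S n (lp_unit i) k - T (lp_unit i) k)) \<longlonglongrightarrow> 0" for i
    proof (rule tendsto_sandwich[OF _ _ tendsto_const LIMSEQ_inverse_real_of_nat])
      show "\<forall>\<^sub>F n in sequentially. lp_norm p (\<lambda>k. S n (lp_unit i) k - T (lp_unit i) k) \<le> inverse (real (Suc n))"
        using eventually_gt_at_top[of i] by (rule eventually_mono) (rule col)
    qed simp
    show "\<forall>\<^sub>F n in sequentially. \<forall>y\<in>lp p. lp_norm p y \<le> 1 \<longrightarrow> norm (S n y j - T y j) \<le> \<epsilon>"
      if "\<epsilon> > 0" for j and \<epsilon> :: real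
    proof -
      have "\<forall>\<^sub>F n in sequentially. inverse (real (Suc n)) < \<epsilon>"
        using LIMSEQ_inverse_real_of_nat that by (rule order_tendstoD)
      with eventually_gt_at_top[of j] show ?thesis
      proof eventually_elim
        case (elim n)
        then show ?case using row[of j n] by fastforce
      qed
    qed
  qed
  then have "\<forall>\<^sub>F n in sequentially. S n \<in> U"
    using U T by (auto simp: limitin_def)
  then show False using S U(2) by (auto simp: eventually_sequentially)
qed

theorem theorem5p12:
  fixes p :: real
    and \<O> :: "((nat \<Rightarrow> complex) \<Rightarrow> (nat \<Rightarrow> complex)) set"
  assumes "2 < p"
    and "\<O> \<subseteq> lp_contractions p"
    and "openin (subtopology (lp_SOT_star p) (lp_contractions p)) \<O>"
  shows "\<O> \<subseteq> subtopology (lp_SOT_star p) (lp_contractions p) closure_of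
               (subtopology (lp_SOT p) (lp_contractions p) interior_of \<O>)
       \<and> \<O> \<subseteq> subtopology (lp_SOT p) (lp_contractions p) closure_of
               (subtopology (lp_SOT p) (lp_contractions p) interior_of \<O>)"
proof -
  let ?C = "lp_contractions p"
  let ?I = "subtopology (lp_SOT p) ?C interior_of \<O>"
  have p1: "p \<ge> 1" using assms(1) by simp
  \<comment> \<open>Treats both density claims at once, for any \<open>Z\<close> whose open sets are
    SOT*-open. A neighbourhood of \<open>T\<close> meets \<open>\<O>\<close> in a nonempty SOT*-open
    set, and the nonempty SOT-interior of that set lies in both.\<close>
  have main: "\<O> \<subseteq> subtopology Z ?C closure_of ?I"
    if Z: "?C \<subseteq> topspace Z" "\<And>U. openin Z U \<Longrightarrow> openin (lp_SOT_star p) U" for Z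
  proof
    fix T assume T: "T \<in> \<O>"
    show "T \<in> subtopology Z ?C closure_of ?I"
      unfolding in_closure_of
    proof (intro conjI allI impI)
      show "T \<in> topspace (subtopology Z ?C)" using T assms(2) Z(1) by auto
      fix U assume U: "T \<in> U \<and> openin (subtopology Z ?C) U"
      then have "openin (subtopology (lp_SOT_star p) ?C) U"
        using Z(2) by (auto simp: openin_subtopology)
      then have "openin (subtopology (lp_SOT_star p) ?C) (U \<inter> \<O>)" using assms(3) by (rule openin_Int)
      then have "subtopology (lp_SOT p) ?C interior_of (U \<inter> \<O>) \<noteq> {}"
        using T U by (intro SOT_star_open_SOT_interior[OF assms(1)]) auto
      then show "\<exists>y. y \<in> ?I \<and> y \<in> U"
        using interior_of_subset[of "subtopology (lp_SOT p) ?C" "U \<inter> \<O>"]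
          interior_of_mono[of "U \<inter> \<O>" \<O> "subtopology (lp_SOT p) ?C"] by blast
    qed
  qed
  show ?thesis
    using main[of "lp_SOT_star p"] main[of "lp_SOT p"] openin_SOT_imp_SOT_star[OF p1]
      lp_contractions_subset[of p] topspace_lp_SOT[OF p1] topspace_lp_SOT_star[OF p1] by simp
qed

end
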